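(* Let $K$ be a field, $n\geq 1$, and let $m\geq 2$ be an integer with $m\notin \mathrm{char}\,K\cdot\mathbb{Z}$. Let $\omega$ be a primitive $m$-th root of unity in $K$. Let $\varphi=\omega\cdot id+\sum_{i=2}^\infty\varphi_i\in G_\infty(n,K)$ (homogeneous decomposition, so $\varphi_1=\omega\cdot id$). Then $\varphi$ is $m$-periodic if and only if $$\varphi_{mk+1}=-\frac{\omega}{m}\left((\varphi_{\leq mk})^m\right)_{mk+1}\quad\text{for every integer } k\geq 1,$$ where $\varphi_{\leq mk}=\sum_{i=1}^{mk}\varphi_i$.
   Context: Every $\varphi\in K[[x_1,\dots,x_n]]^n$ has a unique homogeneous decomposition $\varphi=\sum_{k=0}^\infty\varphi_k$, where $\varphi_k$, also written $(\varphi)_k$, is an $n$-tuple of homogeneous polynomials of degree $k$. $G_\infty(n,K)$ is the set of all $\varphi\in K[[x_1,\dots,x_n]]^n$ with $\varphi_0=0$ and $\varphi_1\in GL_n(K)$ (an $n$-tuple of linear forms $\left(\sum_j a_{1j}x_j,\dots,\sum_j a_{nj}x_j\right)$ is identified with the matrix $(a_{ij})$). It is a group under composition $\varphi\phi=\varphi\circ\phi=(f_1(\phi),\dots,f_n(\phi))$ for $\varphi=(f_1,\dots,f_n)$, with identity $id=(x_1,\dots,x_n)$. Powers such as $(\varphi_{\leq mk})^m$ are $m$-fold compositions. A series is $m$-periodic if its order in the group $G_\infty(n,K)$ equals $m$. A primitive $m$-th root of unity in $K$ is an element of order $m$ in $K^*$. *)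

theory Defs
  imports "HOL-Analysis.Analysis" "HOL-Algebra.Multiplicative_Group"
    "HOL-Algebra.Algebraic_Closure_Type"
begin

unbundle no fps_syntax

section \<open>Formal power series in finitely many variables\<close>

text \<open>
  The variables are indexed by a finite type \<open>'n\<close>, so \<open>n = CARD('n)\<close>. A multi-index is an element
  of \<open>nat ^ 'n\<close>, and a power series is the family of its coefficients.
\<close>

typedef (overloaded) ('a, 'n) mfps = "UNIV :: (nat ^ 'n::finite \<Rightarrow> 'a) set"
  morphisms mfps_nth Abs_mfps
  by simp

lemma mfps_eqI: "(\<And>\<alpha>. mfps_nth f \<alpha> = mfps_nth g \<alpha>) \<Longrightarrow> f = g"
  by (metis ext mfps_nth_inject)

lemma mfps_nth_Abs [simp]: "mfps_nth (Abs_mfps c) = c"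
  by (simp add: Abs_mfps_inverse)

definition mdegree :: "nat ^ 'n::finite \<Rightarrow> nat"
  where "mdegree \<alpha> = (\<Sum>i\<in>UNIV. \<alpha> $ i)"

lemma finite_vec_le: "finite {\<alpha> :: nat ^ 'n::finite. \<forall>i. \<alpha> $ i \<le> b i}"
proof (rule finite_subset)
  show "{\<alpha> :: nat ^ 'n. \<forall>i. \<alpha> $ i \<le> b i} \<subseteq> vec_lambda ` (\<Pi>\<^sub>E i\<in>UNIV. {..b i})"
  proof
    fix \<alpha> :: "nat ^ 'n"
    assume "\<alpha> \<in> {\<alpha>. \<forall>i. \<alpha> $ i \<le> b i}"
    then have "vec_nth \<alpha> \<in> (\<Pi>\<^sub>E i\<in>UNIV. {..b i})" by auto
    then show "\<alpha> \<in> vec_lambda ` (\<Pi>\<^sub>E i\<in>UNIV. {..b i})"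
      by (metis image_eqI vec_nth_inverse)
  qed
  show "finite (vec_lambda ` (\<Pi>\<^sub>E i\<in>(UNIV::'n set). {..b i}))"
    by (intro finite_imageI finite_PiE) auto
qed

lemma finite_mdegree_le: "finite {\<alpha> :: nat ^ 'n::finite. mdegree \<alpha> \<le> d}"
proof (rule finite_subset)
  have "\<alpha> $ i \<le> mdegree \<alpha>" for \<alpha> :: "nat ^ 'n" and i
    unfolding mdegree_def by (rule member_le_sum) auto
  then show "{\<alpha> :: nat ^ 'n. mdegree \<alpha> \<le> d} \<subseteq> {\<alpha>. \<forall>i. \<alpha> $ i \<le> d}"
    using order_trans by blast
qed (rule finite_vec_le)

lemma finite_add_eq: "finite {(\<alpha>, \<beta>). \<alpha> + \<beta> = (\<gamma> :: nat ^ 'n::finite)}"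
proof (rule finite_subset)
  let ?B = "{\<alpha> :: nat ^ 'n. \<forall>i. \<alpha> $ i \<le> \<gamma> $ i}"
  show "{(\<alpha>, \<beta>). \<alpha> + \<beta> = \<gamma>} \<subseteq> ?B \<times> ?B" by auto
  show "finite (?B \<times> ?B)" by (intro finite_cartesian_product finite_vec_le)
qed

instantiation mfps :: (comm_ring_1, finite) comm_ring_1
begin

definition zero_mfps :: "('a, 'b) mfps"
  where "0 = Abs_mfps (\<lambda>_. 0)"

definition one_mfps :: "('a, 'b) mfps"
  where "1 = Abs_mfps (\<lambda>\<alpha>. if \<alpha> = 0 then 1 else 0)"

definition plus_mfps :: "('a, 'b) mfps \<Rightarrow> ('a, 'b) mfps \<Rightarrow> ('a, 'b) mfps"
  where "f + g = Abs_mfps (\<lambda>\<alpha>. mfps_nth f \<alpha> + mfps_nth g \<alpha>)"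

definition uminus_mfps :: "('a, 'b) mfps \<Rightarrow> ('a, 'b) mfps"
  where "- f = Abs_mfps (\<lambda>\<alpha>. - mfps_nth f \<alpha>)"

definition minus_mfps :: "('a, 'b) mfps \<Rightarrow> ('a, 'b) mfps \<Rightarrow> ('a, 'b) mfps"
  where "f - g = Abs_mfps (\<lambda>\<alpha>. mfps_nth f \<alpha> - mfps_nth g \<alpha>)"

definition times_mfps :: "('a, 'b) mfps \<Rightarrow> ('a, 'b) mfps \<Rightarrow> ('a, 'b) mfps"
  where "f * g = Abs_mfps (\<lambda>\<gamma>. \<Sum>(\<alpha>, \<beta>) \<in> {(\<alpha>, \<beta>). \<alpha> + \<beta> = \<gamma>}. mfps_nth f \<alpha> * mfps_nth g \<beta>)"

instance
proof
  fix f g h :: "('a, 'b) mfps"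
  show "f + g + h = f + (g + h)" "f + g = g + f" "0 + f = f" "- f + f = 0" "f - g = f + - g"
    by (auto intro!: mfps_eqI simp: plus_mfps_def zero_mfps_def uminus_mfps_def minus_mfps_def)
  show "(0 :: ('a, 'b) mfps) \<noteq> 1"
  proof
    assume "(0 :: ('a, 'b) mfps) = 1"
    then have "mfps_nth (0 :: ('a, 'b) mfps) 0 = mfps_nth 1 0" by simp
    then show False by (simp add: zero_mfps_def one_mfps_def)
  qed
  show "(f + g) * h = f * h + g * h"
    by (intro mfps_eqI)
      (simp add: plus_mfps_def times_mfps_def algebra_simps sum.distrib case_prod_unfold)
  show "f * g = g * f"
  proof (rule mfps_eqI)
    fix \<gamma>
    show "mfps_nth (f * g) \<gamma> = mfps_nth (g * f) \<gamma>"
      unfolding times_mfps_def mfps_nth_Abs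
      by (rule sum.reindex_bij_witness[where i = prod.swap and j = prod.swap])
        (auto simp: mult.commute add.commute)
  qed
  show "1 * f = f"
  proof (rule mfps_eqI)
    fix \<gamma>
    have "mfps_nth (1 * f) \<gamma> = (\<Sum>(\<alpha>, \<beta>) \<in> {(0, \<gamma>)}. mfps_nth 1 \<alpha> * mfps_nth f \<beta>)"
      unfolding times_mfps_def mfps_nth_Abs
      by (rule sum.mono_neutral_right) (auto simp: finite_add_eq one_mfps_def split: if_splits)
    then show "mfps_nth (1 * f) \<gamma> = mfps_nth f \<gamma>" by (simp add: one_mfps_def)
  qed
  show "f * g * h = f * (g * h)"
  proof (rule mfps_eqI)
    fix \<gamma>
    let ?t = "\<lambda>\<alpha> \<beta> \<delta>. mfps_nth f \<alpha> * mfps_nth g \<beta> * mfps_nth h \<delta>"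
    let ?P = "\<lambda>\<gamma>. {(\<alpha>, \<beta>). \<alpha> + \<beta> = (\<gamma> :: nat ^ 'b)}"
    have "mfps_nth (f * g * h) \<gamma> = (\<Sum>p\<in>?P \<gamma>. \<Sum>q\<in>?P (fst p). ?t (fst q) (snd q) (snd p))"
      by (simp add: times_mfps_def sum_distrib_right case_prod_unfold)
    also have "\<dots> = (\<Sum>(p, q) \<in> (SIGMA p:?P \<gamma>. ?P (fst p)). ?t (fst q) (snd q) (snd p))"
      by (rule sum.Sigma) (auto simp: finite_add_eq)
    also have "\<dots> = (\<Sum>(p, q) \<in> (SIGMA p:?P \<gamma>. ?P (snd p)). ?t (fst p) (fst q) (snd q))"
      by (rule sum.reindex_bij_witness
          [where j = "\<lambda>((a, b), (c, d)). ((c, d + b), (d, b))"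
             and i = "\<lambda>((a, b), (c, d)). ((a + c, d), (a, c))"])
        (auto simp: add.assoc)
    also have "\<dots> = (\<Sum>p\<in>?P \<gamma>. \<Sum>q\<in>?P (snd p). ?t (fst p) (fst q) (snd q))"
      by (rule sum.Sigma[symmetric]) (auto simp: finite_add_eq)
    also have "\<dots> = mfps_nth (f * (g * h)) \<gamma>"
      by (simp add: times_mfps_def sum_distrib_left case_prod_unfold mult.assoc)
    finally show "mfps_nth (f * g * h) \<gamma> = mfps_nth (f * (g * h)) \<gamma>" .
  qed
qed

end

definition mfps_const :: "'a::comm_ring_1 \<Rightarrow> ('a, 'n::finite) mfps"
  where "mfps_const c = Abs_mfps (\<lambda>\<alpha>. if \<alpha> = 0 then c else 0)"

definition mfps_X :: "'n::finite \<Rightarrow> ('a::comm_ring_1, 'n) mfps"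
  where "mfps_X j = Abs_mfps (\<lambda>\<alpha>. if \<alpha> = axis j 1 then 1 else 0)"

definition mfps_homog :: "nat \<Rightarrow> ('a::comm_ring_1, 'n::finite) mfps \<Rightarrow> ('a, 'n) mfps"
  where "mfps_homog k f = Abs_mfps (\<lambda>\<alpha>. if mdegree \<alpha> = k then mfps_nth f \<alpha> else 0)"


section \<open>Tuples of power series and their composition\<close>

type_synonym ('a, 'n) mfps_tuple = "('a, 'n) mfps ^ 'n"

definition homog_part :: "nat \<Rightarrow> ('a::comm_ring_1, 'n::finite) mfps_tuple \<Rightarrow> ('a, 'n) mfps_tuple"
  where "homog_part k \<phi> = (\<chi> i. mfps_homog k (\<phi> $ i))"

definition id_tuple :: "('a::comm_ring_1, 'n::finite) mfps_tuple"
  where "id_tuple = (\<chi> i. mfps_X i)"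

definition scale_tuple ::
    "'a::comm_ring_1 \<Rightarrow> ('a, 'n::finite) mfps_tuple \<Rightarrow> ('a, 'n) mfps_tuple"
  where "scale_tuple c \<phi> = mfps_const c *s \<phi>"

definition linear_matrix :: "('a::comm_ring_1, 'n::finite) mfps_tuple \<Rightarrow> 'a ^ 'n ^ 'n"
  where "linear_matrix \<phi> = (\<chi> i j. mfps_nth (\<phi> $ i) (axis j 1))"

text \<open>
  The series \<open>f(\<psi>) = \<Sum>\<alpha>. f\<^sub>\<alpha> \<psi>\<^sup>\<alpha>\<close>, for \<open>\<psi>\<close> without constant terms. Every monomial of \<open>\<psi>\<^sup>\<alpha>\<close> then has
  degree at least \<open>|\<alpha>|\<close>, so the coefficient at \<open>\<beta>\<close> only involves the finitely many \<open>\<alpha>\<close> with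
  \<open>|\<alpha>| \<le> |\<beta>|\<close>. The definition is meaningless for \<open>\<psi>\<close> with a nonzero constant term.
\<close>

definition mfps_subst ::
    "('a::comm_ring_1, 'n::finite) mfps \<Rightarrow> ('a, 'n) mfps_tuple \<Rightarrow> ('a, 'n) mfps"
  where "mfps_subst f \<psi> = Abs_mfps (\<lambda>\<beta>.
    \<Sum>\<alpha> | mdegree \<alpha> \<le> mdegree \<beta>. mfps_nth f \<alpha> * mfps_nth (\<Prod>i\<in>UNIV. \<psi> $ i ^ \<alpha> $ i) \<beta>)"

definition compose_tuple ::
    "('a::comm_ring_1, 'n::finite) mfps_tuple \<Rightarrow> ('a, 'n) mfps_tuple \<Rightarrow> ('a, 'n) mfps_tuple"
  where "compose_tuple \<phi> \<psi> = (\<chi> i. mfps_subst (\<phi> $ i) \<psi>)"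

definition G_infty :: "('a::field, 'n::finite) mfps_tuple monoid"
  where "G_infty = \<lparr>carrier = {\<phi>. homog_part 0 \<phi> = 0 \<and> invertible (linear_matrix \<phi>)},
    monoid.mult = compose_tuple, one = id_tuple\<rparr>"

text \<open>
  The library's \<open>group.ord\<close> is \<open>0\<close> for elements of infinite order, so the next two notions are the
  intended ones for \<open>m > 0\<close>.
\<close>

definition periodic :: "nat \<Rightarrow> ('a::field, 'n::finite) mfps_tuple \<Rightarrow> bool"
  where "periodic m \<phi> \<longleftrightarrow> \<phi> \<in> carrier G_infty \<and> group.ord G_infty \<phi> = m"

definition primitive_root_of_unity :: "nat \<Rightarrow> 'a::field \<Rightarrow> bool"
  where "primitive_root_of_unity m \<omega> \<longleftrightarrow>
    \<omega> \<in> carrier (units_of (ring_of_type_algebra :: 'a ring)) \<and>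
    group.ord (units_of (ring_of_type_algebra :: 'a ring)) \<omega> = m"

end

(*
  Two congruences modulo terms of degree > d drive the argument, for tuples whose linear part is a
  scalar omega: phi o (psi + h) = phi o psi + omega h and h o phi = omega^d h, whenever h starts in
  degree d.

  If phi^m = id + h with h starting in degree d >= 2, comparing both sides of
  phi o phi^m = phi^m o phi gives omega h_d = omega^d h_d, so h_d = 0 unless m divides d - 1. Hence
  phi^m = id as soon as its parts of degree mk + 1 vanish for all k >= 1. Writing phi = psi + r with
  psi the truncation of phi to degree <= mk, the congruences also give
  (phi^m)_(mk+1) = (psi^m)_(mk+1) + m omega^(m-1) phi_(mk+1), and omega^(m-1) = 1 / omega.
*)
theory Submission
  imports Defs
begin

section \<open>Multi-indices and coefficients\<close>

text \<open>A homogeneous part of a composition mixes many parts of both factors, so the argument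
  uses the filtration by order of vanishing and follows only the leading term of a difference.
  Because \<omega> id is scalar, composing on either side merely multiplies that leading term by a
  constant. In the resonant degrees, where \<omega>^d = \<omega>, commutation says nothing about the
  error, which is why exactly these degrees appear in the criterion. There every one of the m
  factors of \<phi>^m, when perturbed, shifts the leading term equally; this produces the factor m,
  and the hypothesis on the characteristic allows division by it. That the order is m and not a
  proper divisor is read off from linear parts. Speaking of the order at all requires the group
  axioms: associativity rests on substitution being a ring homomorphism, inverses on a contraction
  in the filtration.\<close>

lemma mdegree_0 [simp]: "mdegree 0 = 0"
  by (simp add: mdegree_def)

lemma mdegree_add [simp]: "mdegree (\<alpha> + \<beta>) = mdegree \<alpha> + mdegree \<beta>"
  by (simp add: mdegree_def sum.distrib)

lemma mdegree_axis [simp]: "mdegree (axis j k) = k"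
  by (simp add: mdegree_def axis_def)

lemma mdegree_eq_0_iff [simp]: "mdegree \<alpha> = 0 \<longleftrightarrow> \<alpha> = 0"
  by (auto simp: mdegree_def vec_eq_iff)

lemma nonzero_multi_index_obtain:
  fixes \<alpha> :: "nat ^ 'n::finite"
  assumes "\<alpha> \<noteq> 0"
  obtains j \<beta> where "\<alpha> = \<beta> + axis j 1"
proof -
  from assms obtain j where "\<alpha> $ j \<noteq> 0"
    by (auto simp: vec_eq_iff)
  then have "\<alpha> = (\<alpha> - axis j 1) + axis j 1"
    by (auto simp: vec_eq_iff axis_def)
  then show thesis
    by (rule that)
qed

lemma mdegree_eq_1_iff: "mdegree \<alpha> = 1 \<longleftrightarrow> (\<exists>j. \<alpha> = axis j 1)"
proof
  assume *: "mdegree \<alpha> = 1"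
  then have "\<alpha> \<noteq> 0" by auto
  then obtain j \<beta> where \<alpha>: "\<alpha> = \<beta> + axis j 1" by (rule nonzero_multi_index_obtain)
  with * have "\<beta> = 0" by simp
  with \<alpha> show "\<exists>j. \<alpha> = axis j 1" by auto
qed auto

lemma finite_mdegree_less [simp]: "finite {\<alpha> :: nat ^ 'n::finite. mdegree \<alpha> < d}"
  by (rule finite_subset[OF _ finite_mdegree_le[of d]]) auto

lemma mfps_nth_0 [simp]: "mfps_nth 0 \<alpha> = 0"
  by (simp add: zero_mfps_def)

lemma mfps_nth_1 [simp]: "mfps_nth 1 \<alpha> = (if \<alpha> = 0 then 1 else 0)"
  by (simp add: one_mfps_def)

lemma mfps_nth_add [simp]: "mfps_nth (f + g) \<alpha> = mfps_nth f \<alpha> + mfps_nth g \<alpha>"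
  by (simp add: plus_mfps_def)

lemma mfps_nth_diff [simp]: "mfps_nth (f - g) \<alpha> = mfps_nth f \<alpha> - mfps_nth g \<alpha>"
  by (simp add: minus_mfps_def)

lemma mfps_nth_sum [simp]: "mfps_nth (\<Sum>x\<in>A. f x) \<alpha> = (\<Sum>x\<in>A. mfps_nth (f x) \<alpha>)"
  by (induction A rule: infinite_finite_induct) auto

lemma mfps_nth_const: "mfps_nth (mfps_const c) \<alpha> = (if \<alpha> = 0 then c else 0)"
  by (simp add: mfps_const_def)

lemma mfps_nth_homog: "mfps_nth (mfps_homog k f) \<alpha> = (if mdegree \<alpha> = k then mfps_nth f \<alpha> else 0)"
  by (simp add: mfps_homog_def)

lemma mfps_nth_X: "mfps_nth (mfps_X j) \<alpha> = (if \<alpha> = axis j 1 then 1 else 0)"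
  by (simp add: mfps_X_def)

lemma mfps_nth_mult:
  "mfps_nth (f * g) \<gamma> = (\<Sum>(\<alpha>, \<beta>) \<in> {(\<alpha>, \<beta>). \<alpha> + \<beta> = \<gamma>}. mfps_nth f \<alpha> * mfps_nth g \<beta>)"
  by (simp add: times_mfps_def)

lemma mfps_nth_const_mult [simp]:
  fixes f :: "('a::comm_ring_1, 'n::finite) mfps"
  shows "mfps_nth (mfps_const c * f) \<gamma> = c * mfps_nth f \<gamma>"
proof -
  have "mfps_nth (mfps_const c * f) \<gamma>
      = (\<Sum>(\<alpha>, \<beta>) \<in> {(0, \<gamma>)}. mfps_nth (mfps_const c :: ('a, 'n) mfps) \<alpha> * mfps_nth f \<beta>)"
    unfolding mfps_nth_mult
    by (rule sum.mono_neutral_right) (auto simp: finite_add_eq mfps_nth_const split: if_splits)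
  then show ?thesis by (simp add: mfps_nth_const)
qed

lemma mfps_const_1 [simp]: "mfps_const 1 = 1"
  by (rule mfps_eqI) (simp add: mfps_nth_const)

lemma mfps_const_add: "mfps_const (a + b) = mfps_const a + mfps_const b"
  by (rule mfps_eqI) (simp add: mfps_nth_const)

lemma mfps_const_mult: "mfps_const (a * b) = mfps_const a * mfps_const b"
  by (rule mfps_eqI) (simp add: mfps_nth_const)

lemma mfps_const_power: "mfps_const (a ^ k) = mfps_const a ^ k"
  by (induction k) (auto simp: mfps_const_mult)

lemma mfps_const_prod: "mfps_const (\<Prod>x\<in>A. f x) = (\<Prod>x\<in>A. mfps_const (f x))"
  by (induction A rule: infinite_finite_induct) (auto simp: mfps_const_mult)

lemma mfps_const_sum: "mfps_const (\<Sum>x\<in>A. f x) = (\<Sum>x\<in>A. mfps_const (f x))"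
  by (rule mfps_eqI) (simp add: mfps_nth_const)


section \<open>Congruence modulo terms of high degree\<close>

text \<open>The d-th power of the ideal generated by the variables. A difference lying in it is a
  congruence modulo terms of degree at least d, which lets infinite sums be replaced by finite
  ones.\<close>

definition mfps_ideal :: "nat \<Rightarrow> ('a::comm_ring_1, 'n::finite) mfps set"
  where "mfps_ideal d = {f. \<forall>\<alpha>. mdegree \<alpha> < d \<longrightarrow> mfps_nth f \<alpha> = 0}"

lemma mfps_idealI: "(\<And>\<alpha>. mdegree \<alpha> < d \<Longrightarrow> mfps_nth f \<alpha> = 0) \<Longrightarrow> f \<in> mfps_ideal d"
  by (simp add: mfps_ideal_def)

lemma mfps_idealD: "f \<in> mfps_ideal d \<Longrightarrow> mdegree \<alpha> < d \<Longrightarrow> mfps_nth f \<alpha> = 0"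
  by (simp add: mfps_ideal_def)

lemma mfps_ideal_0 [simp]: "f \<in> mfps_ideal 0"
  by (simp add: mfps_ideal_def)

lemma mfps_ideal_mono: "f \<in> mfps_ideal d \<Longrightarrow> e \<le> d \<Longrightarrow> f \<in> mfps_ideal e"
  by (simp add: mfps_ideal_def)

lemma zero_in_mfps_ideal [simp]: "0 \<in> mfps_ideal d"
  by (simp add: mfps_ideal_def)

lemma mfps_ideal_add: "f \<in> mfps_ideal d \<Longrightarrow> g \<in> mfps_ideal d \<Longrightarrow> f + g \<in> mfps_ideal d"
  by (simp add: mfps_ideal_def)

lemma mfps_ideal_diff: "f \<in> mfps_ideal d \<Longrightarrow> g \<in> mfps_ideal d \<Longrightarrow> f - g \<in> mfps_ideal d"
  by (simp add: mfps_ideal_def)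

lemma mfps_ideal_sum: "(\<And>x. x \<in> A \<Longrightarrow> f x \<in> mfps_ideal d) \<Longrightarrow> (\<Sum>x\<in>A. f x) \<in> mfps_ideal d"
  by (induction A rule: infinite_finite_induct) (auto intro: mfps_ideal_add)

lemma mfps_ideal_diff_commute: "f - g \<in> mfps_ideal d \<longleftrightarrow> g - f \<in> mfps_ideal d"
  by (auto simp: mfps_ideal_def)

lemma mfps_ideal_diff_trans:
  assumes "f - g \<in> mfps_ideal d" "g - h \<in> mfps_ideal d"
  shows "f - h \<in> mfps_ideal d"
  using mfps_ideal_add[OF assms] by simp

lemma mfps_ideal_mult:
  assumes "f \<in> mfps_ideal a" "g \<in> mfps_ideal b"
  shows "f * g \<in> mfps_ideal (a + b)"
proof (rule mfps_idealI)
  fix \<gamma> :: "nat ^ 'b"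
  assume *: "mdegree \<gamma> < a + b"
  have "mfps_nth f \<alpha> * mfps_nth g \<beta> = 0" if "\<alpha> + \<beta> = \<gamma>" for \<alpha> \<beta>
  proof -
    have "mdegree \<alpha> < a \<or> mdegree \<beta> < b"
      using * that by auto
    then show ?thesis
      using assms by (auto dest: mfps_idealD)
  qed
  then show "mfps_nth (f * g) \<gamma> = 0"
    by (auto simp: mfps_nth_mult intro!: sum.neutral)
qed

lemma mfps_ideal_mult_left: "g \<in> mfps_ideal b \<Longrightarrow> f * g \<in> mfps_ideal b"
  using mfps_ideal_mult[of f 0 g b] by simp

lemma mfps_ideal_prod:
  "(\<And>i. i \<in> A \<Longrightarrow> f i \<in> mfps_ideal (k i)) \<Longrightarrow> (\<Prod>i\<in>A. f i) \<in> mfps_ideal (\<Sum>i\<in>A. k i)"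
  by (induction A rule: infinite_finite_induct) (auto intro: mfps_ideal_mult)

lemma mfps_ideal_power: "f \<in> mfps_ideal k \<Longrightarrow> f ^ n \<in> mfps_ideal (n * k)"
  by (induction n) (auto intro: mfps_ideal_mult)

text \<open>The filtration is separated, so an identity of series may be checked modulo every
  d.\<close>

lemma mfps_eqI_ideal:
  assumes "\<And>d. f - g \<in> mfps_ideal d"
  shows "f = g"
proof (rule mfps_eqI)
  fix \<alpha>
  show "mfps_nth f \<alpha> = mfps_nth g \<alpha>"
    using mfps_idealD[OF assms, of \<alpha> "Suc (mdegree \<alpha>)"] by simp
qed

text \<open>Here a and b are orders of vanishing and e is a relative precision: under multiplication
  orders add while the precision stays. It follows from f g - f' g' = f (g - g') + (f - f')
  g'.\<close>

lemma mfps_ideal_mult_diff: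
  assumes "f \<in> mfps_ideal a" "g' \<in> mfps_ideal b"
    and "f - f' \<in> mfps_ideal (a + e)" "g - g' \<in> mfps_ideal (b + e)"
  shows "f * g - f' * g' \<in> mfps_ideal (a + b + e)"
proof -
  have "f * (g - g') \<in> mfps_ideal (a + b + e)"
    using mfps_ideal_mult[OF assms(1,4)] by (simp add: add.assoc)
  moreover have "(f - f') * g' \<in> mfps_ideal (a + b + e)"
    using mfps_ideal_mult[OF assms(3,2)] by (simp add: add_ac)
  ultimately have "f * (g - g') + (f - f') * g' \<in> mfps_ideal (a + b + e)"
    by (rule mfps_ideal_add)
  then show ?thesis
    by (simp add: algebra_simps)
qed

lemma mfps_ideal_mult_cong:
  assumes "f - f' \<in> mfps_ideal e" "g - g' \<in> mfps_ideal e"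
  shows "f * g - f' * g' \<in> mfps_ideal e"
  using mfps_ideal_mult_diff[of f 0 g' 0] assms by simp

lemma mfps_ideal_prod_diff:
  assumes "\<And>i. i \<in> A \<Longrightarrow> f i \<in> mfps_ideal (k i)" "\<And>i. i \<in> A \<Longrightarrow> g i \<in> mfps_ideal (k i)"
    and "\<And>i. i \<in> A \<Longrightarrow> f i - g i \<in> mfps_ideal (k i + e)"
  shows "(\<Prod>i\<in>A. f i) - (\<Prod>i\<in>A. g i) \<in> mfps_ideal ((\<Sum>i\<in>A. k i) + e)"
  using assms
proof (induction A rule: infinite_finite_induct)
  case (insert x F)
  then show ?case
    by (auto intro!: mfps_ideal_mult_diff mfps_ideal_prod)
qed auto

lemma mfps_ideal_power_diff:
  assumes "f \<in> mfps_ideal k" "g \<in> mfps_ideal k" "f - g \<in> mfps_ideal (k + e)"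
  shows "f ^ n - g ^ n \<in> mfps_ideal (n * k + e)"
proof (induction n)
  case (Suc n)
  then show ?case
    using mfps_ideal_mult_diff[of f k "g ^ n" "n * k" g e "f ^ n"] assms
    by (auto intro: mfps_ideal_power)
qed auto


section \<open>Substitution\<close>

definition mpow :: "('a::comm_ring_1, 'n::finite) mfps_tuple \<Rightarrow> nat ^ 'n \<Rightarrow> ('a, 'n) mfps"
  where "mpow \<psi> \<alpha> = (\<Prod>i\<in>UNIV. \<psi> $ i ^ \<alpha> $ i)"

definition tuple_ideal :: "nat \<Rightarrow> ('a::comm_ring_1, 'n::finite) mfps_tuple set"
  where "tuple_ideal d = {\<psi>. \<forall>i. \<psi> $ i \<in> mfps_ideal d}"

lemma tuple_idealI: "(\<And>i. \<psi> $ i \<in> mfps_ideal d) \<Longrightarrow> \<psi> \<in> tuple_ideal d"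
  by (simp add: tuple_ideal_def)

lemma tuple_idealD: "\<psi> \<in> tuple_ideal d \<Longrightarrow> \<psi> $ i \<in> mfps_ideal d"
  by (simp add: tuple_ideal_def)

lemma mpow_0 [simp]: "mpow \<psi> 0 = 1"
  by (simp add: mpow_def)

lemma mpow_add: "mpow \<psi> (\<alpha> + \<beta>) = mpow \<psi> \<alpha> * mpow \<psi> \<beta>"
  by (simp add: mpow_def power_add prod.distrib)

lemma mpow_axis [simp]: "mpow \<psi> (axis j (Suc 0)) = \<psi> $ j"
proof -
  have "mpow \<psi> (axis j (Suc 0)) = (\<Prod>i\<in>UNIV. if i = j then \<psi> $ i else 1)"
    unfolding mpow_def by (rule prod.cong) (auto simp: axis_def)
  then show ?thesis by simp
qed

lemma mpow_in_ideal: "\<psi> \<in> tuple_ideal 1 \<Longrightarrow> mpow \<psi> \<alpha> \<in> mfps_ideal (mdegree \<alpha>)"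
  unfolding mpow_def mdegree_def
  by (rule mfps_ideal_prod) (metis mfps_ideal_power mult_1_right tuple_idealD)

text \<open>Telescoping replaces one factor at a time: a difference of order 1 + e meets |\<alpha>|
  - 1 factors of order 1.\<close>

lemma mpow_diff_in_ideal:
  assumes "\<psi> \<in> tuple_ideal 1" "\<psi>' \<in> tuple_ideal 1" "\<psi> - \<psi>' \<in> tuple_ideal (1 + e)"
  shows "mpow \<psi> \<alpha> - mpow \<psi>' \<alpha> \<in> mfps_ideal (mdegree \<alpha> + e)"
  unfolding mpow_def mdegree_def
proof (rule mfps_ideal_prod_diff)
  fix i
  have "\<psi> $ i \<in> mfps_ideal 1" "\<psi>' $ i \<in> mfps_ideal 1"
    using assms by (auto dest: tuple_idealD)
  moreover have "\<psi> $ i - \<psi>' $ i \<in> mfps_ideal (1 + e)"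
    using tuple_idealD[OF assms(3), of i] by simp
  ultimately show "\<psi> $ i ^ \<alpha> $ i \<in> mfps_ideal (\<alpha> $ i)" "\<psi>' $ i ^ \<alpha> $ i \<in> mfps_ideal (\<alpha> $ i)"
      "\<psi> $ i ^ \<alpha> $ i - \<psi>' $ i ^ \<alpha> $ i \<in> mfps_ideal (\<alpha> $ i + e)"
    by (metis mfps_ideal_power mult_1_right, metis mfps_ideal_power mult_1_right,
        metis mfps_ideal_power_diff mult_1_right)
qed

lemma mfps_nth_subst:
  "mfps_nth (mfps_subst f \<psi>) \<beta>
    = (\<Sum>\<alpha> | mdegree \<alpha> \<le> mdegree \<beta>. mfps_nth f \<alpha> * mfps_nth (mpow \<psi> \<alpha>) \<beta>)"
  by (simp add: mfps_subst_def mpow_def)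

lemma mfps_subst_add: "mfps_subst (f + g) \<psi> = mfps_subst f \<psi> + mfps_subst g \<psi>"
  by (rule mfps_eqI) (simp add: mfps_nth_subst algebra_simps sum.distrib)

lemma mfps_subst_diff: "mfps_subst (f - g) \<psi> = mfps_subst f \<psi> - mfps_subst g \<psi>"
  by (rule mfps_eqI) (simp add: mfps_nth_subst algebra_simps sum_subtractf)

lemma mfps_subst_0 [simp]: "mfps_subst 0 \<psi> = 0"
  by (rule mfps_eqI) (simp add: mfps_nth_subst)

lemma mfps_subst_sum: "mfps_subst (\<Sum>x\<in>A. f x) \<psi> = (\<Sum>x\<in>A. mfps_subst (f x) \<psi>)"
  by (induction A rule: infinite_finite_induct) (auto simp: mfps_subst_add)

lemma mfps_subst_const_mult: "mfps_subst (mfps_const c * f) \<psi> = mfps_const c * mfps_subst f \<psi>"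
  by (rule mfps_eqI) (simp add: mfps_nth_subst sum_distrib_left mult.assoc)

lemma mfps_subst_in_ideal: "f \<in> mfps_ideal d \<Longrightarrow> mfps_subst f \<psi> \<in> mfps_ideal d"
  by (rule mfps_idealI) (auto simp: mfps_nth_subst mfps_idealD intro!: sum.neutral)

text \<open>Substitution sums over |\<alpha>| \<le> |\<beta>|, but larger \<alpha> contribute
  nothing at \<beta>, since \<psi>^\<alpha> has order |\<alpha>|. Hence one finite sum, independent
  of \<beta>, serves all degrees below d.\<close>

lemma mfps_subst_approx:
  assumes "\<psi> \<in> tuple_ideal 1"
  shows "mfps_subst f \<psi> - (\<Sum>\<alpha> | mdegree \<alpha> < d. mfps_const (mfps_nth f \<alpha>) * mpow \<psi> \<alpha>)
    \<in> mfps_ideal d"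
proof (rule mfps_idealI)
  fix \<beta> :: "nat ^ 'b"
  assume *: "mdegree \<beta> < d"
  have "mfps_nth (mfps_subst f \<psi>) \<beta>
      = (\<Sum>\<alpha> | mdegree \<alpha> < d. mfps_nth f \<alpha> * mfps_nth (mpow \<psi> \<alpha>) \<beta>)"
    unfolding mfps_nth_subst
  proof (rule sum.mono_neutral_left)
    show "\<forall>\<alpha>\<in>{\<alpha>. mdegree \<alpha> < d} - {\<alpha>. mdegree \<alpha> \<le> mdegree \<beta>}.
        mfps_nth f \<alpha> * mfps_nth (mpow \<psi> \<alpha>) \<beta> = 0"
      using mfps_idealD[OF mpow_in_ideal[OF assms]] by auto
  qed (use * in auto)
  then show "mfps_nth (mfps_subst f \<psi>
      - (\<Sum>\<alpha> | mdegree \<alpha> < d. mfps_const (mfps_nth f \<alpha>) * mpow \<psi> \<alpha>)) \<beta> = 0"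
    by simp
qed

text \<open>Modulo degree d both sides are finite sums. The truncation of f g collects the pairs of
  total degree below d, the product of truncations all pairs with each degree below d; the surplus
  pairs have total degree at least d and vanish.\<close>

lemma mfps_subst_mult:
  assumes \<psi>: "\<psi> \<in> tuple_ideal 1"
  shows "mfps_subst (f * g) \<psi> = mfps_subst f \<psi> * mfps_subst g \<psi>"
proof (rule mfps_eqI_ideal)
  fix d
  let ?D = "{\<alpha> :: nat ^ 'b. mdegree \<alpha> < d}"
  let ?S = "\<lambda>f. \<Sum>\<alpha>\<in>?D. mfps_const (mfps_nth f \<alpha>) * mpow \<psi> \<alpha>"
  let ?P = "{(\<alpha>, \<beta>). mdegree (\<alpha> + \<beta> :: nat ^ 'b) < d}"
  let ?t = "\<lambda>(\<alpha>, \<beta>). mfps_const (mfps_nth f \<alpha> * mfps_nth g \<beta>) * mpow \<psi> (\<alpha> + \<beta>)"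
  have "?S (f * g) = (\<Sum>\<gamma>\<in>?D. \<Sum>p\<in>{(\<alpha>, \<beta>). \<alpha> + \<beta> = \<gamma>}. ?t p)"
    by (intro sum.cong refl)
      (auto simp: mfps_nth_mult mfps_const_sum sum_distrib_right intro!: sum.cong)
  also have "\<dots> = (\<Sum>(\<gamma>, p) \<in> (SIGMA \<gamma>:?D. {(\<alpha>, \<beta>). \<alpha> + \<beta> = \<gamma>}). ?t p)"
    by (rule sum.Sigma) (auto simp: finite_add_eq)
  also have "\<dots> = (\<Sum>p\<in>?P. ?t p)"
    by (rule sum.reindex_bij_witness[where i = "\<lambda>(\<alpha>, \<beta>). (\<alpha> + \<beta>, \<alpha>, \<beta>)" and j = snd]) auto
  finally have fg: "?S (f * g) = (\<Sum>p\<in>?P. ?t p)" .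
  have "?S f * ?S g = (\<Sum>p\<in>?D \<times> ?D. ?t p)"
    by (simp add: sum_product sum.cartesian_product mfps_const_mult mpow_add mult_ac)
  also have "\<dots> = (\<Sum>p\<in>?P. ?t p) + (\<Sum>p\<in>?D \<times> ?D - ?P. ?t p)"
    by (subst add.commute, rule sum.subset_diff) auto
  finally have "?S f * ?S g - ?S (f * g) = (\<Sum>p\<in>?D \<times> ?D - ?P. ?t p)"
    using fg by simp
  also have "\<dots> \<in> mfps_ideal d"
  proof (rule mfps_ideal_sum)
    fix p
    assume p: "p \<in> ?D \<times> ?D - ?P"
    obtain \<alpha> \<beta> where [simp]: "p = (\<alpha>, \<beta>)" by force
    have "mpow \<psi> (\<alpha> + \<beta>) \<in> mfps_ideal d"
      by (rule mfps_ideal_mono[OF mpow_in_ideal[OF \<psi>]]) (use p in auto)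
    then show "?t p \<in> mfps_ideal d"
      by (simp add: mfps_ideal_mult_left)
  qed
  finally have "?S f * ?S g - ?S (f * g) \<in> mfps_ideal d" .
  moreover have "mfps_subst f \<psi> * mfps_subst g \<psi> - ?S f * ?S g \<in> mfps_ideal d"
    by (intro mfps_ideal_mult_cong mfps_subst_approx \<psi>)
  moreover have "?S (f * g) - mfps_subst (f * g) \<psi> \<in> mfps_ideal d"
    using mfps_subst_approx[OF \<psi>] mfps_ideal_diff_commute by blast
  ultimately show "mfps_subst (f * g) \<psi> - mfps_subst f \<psi> * mfps_subst g \<psi> \<in> mfps_ideal d"
    using mfps_ideal_diff_trans mfps_ideal_diff_commute by blast
qed

lemma mfps_subst_1 [simp]: "mfps_subst 1 \<psi> = 1"
proof (rule mfps_eqI)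
  fix \<beta>
  have "mfps_nth (mfps_subst 1 \<psi>) \<beta> = (\<Sum>\<alpha>\<in>{0}. mfps_nth 1 \<alpha> * mfps_nth (mpow \<psi> \<alpha>) \<beta>)"
    unfolding mfps_nth_subst by (rule sum.mono_neutral_right) (auto simp: finite_mdegree_le)
  then show "mfps_nth (mfps_subst 1 \<psi>) \<beta> = mfps_nth 1 \<beta>"
    by simp
qed

lemma mfps_subst_power:
  "\<psi> \<in> tuple_ideal 1 \<Longrightarrow> mfps_subst (f ^ k) \<psi> = mfps_subst f \<psi> ^ k"
  by (induction k) (auto simp: mfps_subst_mult)

lemma mfps_subst_prod:
  "\<psi> \<in> tuple_ideal 1 \<Longrightarrow> mfps_subst (\<Prod>x\<in>A. f x) \<psi> = (\<Prod>x\<in>A. mfps_subst (f x) \<psi>)"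
  by (induction A rule: infinite_finite_induct) (auto simp: mfps_subst_mult)

lemma mfps_subst_X:
  assumes "\<psi> \<in> tuple_ideal 1"
  shows "mfps_subst (mfps_X j) \<psi> = \<psi> $ j"
proof (rule mfps_eqI)
  fix \<beta> :: "nat ^ 'b"
  show "mfps_nth (mfps_subst (mfps_X j) \<psi>) \<beta> = mfps_nth (\<psi> $ j) \<beta>"
  \<comment> \<open>At \<beta> = 0 the range of summation does not contain the unit vector of
    \<open>mfps_X j\<close>; both sides are then 0 because \<psi> has no constant term.\<close>
  proof (cases "\<beta> = 0")
    case True
    have "axis j 1 \<noteq> (0 :: nat ^ 'b)"
      by (metis mdegree_axis mdegree_0 one_neq_zero)
    then show ?thesis
      using True mfps_idealD[OF tuple_idealD[OF assms], of \<beta> j]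
      by (auto simp: mfps_nth_subst mfps_nth_X)
  next
    case False
    have "mfps_nth (mfps_subst (mfps_X j) \<psi>) \<beta>
        = (\<Sum>\<alpha>\<in>{axis j 1}. mfps_nth (mfps_X j) \<alpha> * mfps_nth (mpow \<psi> \<alpha>) \<beta>)"
      unfolding mfps_nth_subst
    proof (rule sum.mono_neutral_right)
      show "{axis j 1} \<subseteq> {\<alpha> :: nat ^ 'b. mdegree \<alpha> \<le> mdegree \<beta>}"
        using False mdegree_eq_0_iff[of \<beta>] by (auto simp: Suc_le_eq simp del: mdegree_eq_0_iff)
    qed (auto simp: finite_mdegree_le mfps_nth_X)
    then show ?thesis by (simp add: mfps_nth_X)
  qed
qed

text \<open>Induction on the degree: after peeling off one variable, the convolution retains a
  single pair. This yields f(id) = f and, after scaling, the action of c id on coefficients.\<close>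

lemma mfps_nth_mpow_id:
  "mfps_nth (mpow (id_tuple :: ('a::comm_ring_1, 'n::finite) mfps_tuple) \<alpha>) \<beta>
    = (if \<beta> = \<alpha> then 1 else 0)"
proof (induction "mdegree \<alpha>" arbitrary: \<alpha> \<beta>)
  case 0
  then show ?case by simp
next
  case (Suc d)
  from Suc.hyps(2) have "\<alpha> \<noteq> 0" by auto
  then obtain j \<gamma> where \<alpha>: "\<alpha> = \<gamma> + axis j 1" by (rule nonzero_multi_index_obtain)
  then have "d = mdegree \<gamma>" using Suc.hyps(2) by simp
  note IH = Suc.hyps(1)[OF this]
  have "mfps_nth (mpow (id_tuple :: ('a, 'n) mfps_tuple) \<alpha>) \<beta> = (\<Sum>(a, b) \<in> {(a, b). a + b = \<beta>}.
      (if a = \<gamma> then 1 else 0) * (if b = axis j 1 then 1 else 0))"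
    by (simp add: \<alpha> mpow_add mfps_nth_mult IH) (simp add: id_tuple_def mfps_nth_X)
  also have "\<dots> = (\<Sum>(a, b) \<in> {(a, b). a + b = \<beta>}. if (a, b) = (\<gamma>, axis j 1) then 1 else 0)"
    by (rule sum.cong) auto
  also have "\<dots> = (if \<beta> = \<alpha> then 1 else 0)"
    by (subst case_prod_unfold) (auto simp: finite_add_eq \<alpha>)
  finally show ?case .
qed

lemma mfps_subst_id [simp]: "mfps_subst f id_tuple = f"
  by (rule mfps_eqI) (simp add: mfps_nth_subst mfps_nth_mpow_id finite_mdegree_le if_distrib[of "(*) _"]
      cong: if_cong)

text \<open>Indices with |\<alpha>| < d are killed by f; for the others the change in
  \<psi>^\<alpha> has order at least d + e. Every order of f beyond 1 thus gains precision, the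
  source of both the contraction and the two congruences.\<close>

lemma mfps_subst_diff_in_ideal:
  assumes f: "f \<in> mfps_ideal d"
    and \<psi>: "\<psi> \<in> tuple_ideal 1" "\<psi>' \<in> tuple_ideal 1" "\<psi> - \<psi>' \<in> tuple_ideal (1 + e)"
  shows "mfps_subst f \<psi> - mfps_subst f \<psi>' \<in> mfps_ideal (d + e)"
proof (rule mfps_idealI)
  fix \<beta> :: "nat ^ 'b"
  assume *: "mdegree \<beta> < d + e"
  have "mfps_nth f \<alpha> * (mfps_nth (mpow \<psi> \<alpha>) \<beta> - mfps_nth (mpow \<psi>' \<alpha>) \<beta>) = 0" for \<alpha>
  proof (cases "mdegree \<alpha> < d")
    case True
    then show ?thesis using f by (simp add: mfps_idealD)
  next
    case False
    then show ?thesis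
      using mfps_idealD[OF mpow_diff_in_ideal[OF \<psi>], of \<beta> \<alpha>] * by simp
  qed
  then show "mfps_nth (mfps_subst f \<psi> - mfps_subst f \<psi>') \<beta> = 0"
    by (simp add: mfps_nth_subst sum_subtractf[symmetric] right_diff_distrib[symmetric])
qed


section \<open>The group of tuples\<close>

lemma compose_tuple_nth [simp]: "compose_tuple \<phi> \<psi> $ i = mfps_subst (\<phi> $ i) \<psi>"
  by (simp add: compose_tuple_def)

lemma compose_tuple_in_ideal: "\<phi> \<in> tuple_ideal d \<Longrightarrow> compose_tuple \<phi> \<psi> \<in> tuple_ideal d"
  by (auto simp: tuple_ideal_def mfps_subst_in_ideal)

lemma mfps_subst_mpow:
  "\<rho> \<in> tuple_ideal 1 \<Longrightarrow> mfps_subst (mpow \<psi> \<alpha>) \<rho> = mpow (compose_tuple \<psi> \<rho>) \<alpha>"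
  by (simp add: mpow_def mfps_subst_prod mfps_subst_power)

text \<open>Modulo degree d, f(\<psi>) is a polynomial in the components of \<psi>, and substituting
  \<rho> into a polynomial may be done factor by factor because substitution is a ring
  homomorphism.\<close>

lemma mfps_subst_subst:
  assumes \<psi>: "\<psi> \<in> tuple_ideal 1" and \<rho>: "\<rho> \<in> tuple_ideal 1"
  shows "mfps_subst (mfps_subst f \<psi>) \<rho> = mfps_subst f (compose_tuple \<psi> \<rho>)"
proof (rule mfps_eqI_ideal)
  fix d
  let ?S = "\<lambda>\<psi>. \<Sum>\<alpha> | mdegree \<alpha> < d. mfps_const (mfps_nth f \<alpha>) * mpow \<psi> \<alpha>"
  have "mfps_subst (mfps_subst f \<psi> - ?S \<psi>) \<rho> \<in> mfps_ideal d"
    by (intro mfps_subst_in_ideal mfps_subst_approx \<psi>)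
  then have "mfps_subst (mfps_subst f \<psi>) \<rho> - ?S (compose_tuple \<psi> \<rho>) \<in> mfps_ideal d"
    by (simp add: mfps_subst_diff mfps_subst_sum mfps_subst_const_mult mfps_subst_mpow[OF \<rho>])
  moreover have "mfps_subst f (compose_tuple \<psi> \<rho>) - ?S (compose_tuple \<psi> \<rho>) \<in> mfps_ideal d"
    by (intro mfps_subst_approx compose_tuple_in_ideal \<psi>)
  ultimately show "mfps_subst (mfps_subst f \<psi>) \<rho> - mfps_subst f (compose_tuple \<psi> \<rho>)
      \<in> mfps_ideal d"
    using mfps_ideal_diff_trans mfps_ideal_diff_commute by blast
qed

lemma compose_tuple_assoc:
  assumes "\<psi> \<in> tuple_ideal 1" "\<rho> \<in> tuple_ideal 1"
  shows "compose_tuple (compose_tuple \<phi> \<psi>) \<rho> = compose_tuple \<phi> (compose_tuple \<psi> \<rho>)"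
  using assms by (simp add: vec_eq_iff mfps_subst_subst)

lemma compose_tuple_id_right [simp]: "compose_tuple \<phi> id_tuple = \<phi>"
  by (simp add: vec_eq_iff)

lemma compose_tuple_id_left: "\<phi> \<in> tuple_ideal 1 \<Longrightarrow> compose_tuple id_tuple \<phi> = \<phi>"
  by (simp add: vec_eq_iff id_tuple_def mfps_subst_X)

lemma compose_tuple_add: "compose_tuple (\<phi> + \<phi>') \<psi> = compose_tuple \<phi> \<psi> + compose_tuple \<phi>' \<psi>"
  by (simp add: vec_eq_iff mfps_subst_add)

lemma compose_tuple_diff: "compose_tuple (\<phi> - \<phi>') \<psi> = compose_tuple \<phi> \<psi> - compose_tuple \<phi>' \<psi>"
  by (simp add: vec_eq_iff mfps_subst_diff)

lemma compose_tuple_diff_in_ideal: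
  assumes "\<phi> \<in> tuple_ideal d" "\<psi> \<in> tuple_ideal 1" "\<psi>' \<in> tuple_ideal 1"
    and "\<psi> - \<psi>' \<in> tuple_ideal (1 + e)"
  shows "compose_tuple \<phi> \<psi> - compose_tuple \<phi> \<psi>' \<in> tuple_ideal (d + e)"
proof (rule tuple_idealI)
  fix i
  show "(compose_tuple \<phi> \<psi> - compose_tuple \<phi> \<psi>') $ i \<in> mfps_ideal (d + e)"
    using mfps_subst_diff_in_ideal[OF tuple_idealD[OF assms(1)] assms(2-4)] by simp
qed

lemma tuple_ideal_0 [simp]: "\<phi> \<in> tuple_ideal 0"
  by (simp add: tuple_ideal_def)

lemma tuple_ideal_mono: "\<phi> \<in> tuple_ideal d \<Longrightarrow> e \<le> d \<Longrightarrow> \<phi> \<in> tuple_ideal e"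
  by (auto simp: tuple_ideal_def intro: mfps_ideal_mono)

lemma tuple_ideal_add: "\<phi> \<in> tuple_ideal d \<Longrightarrow> \<psi> \<in> tuple_ideal d \<Longrightarrow> \<phi> + \<psi> \<in> tuple_ideal d"
  by (simp add: tuple_ideal_def mfps_ideal_add)

lemma tuple_ideal_diff: "\<phi> \<in> tuple_ideal d \<Longrightarrow> \<psi> \<in> tuple_ideal d \<Longrightarrow> \<phi> - \<psi> \<in> tuple_ideal d"
  by (simp add: tuple_ideal_def mfps_ideal_diff)

lemma tuple_ideal_diff_commute: "\<phi> - \<psi> \<in> tuple_ideal d \<longleftrightarrow> \<psi> - \<phi> \<in> tuple_ideal d"
  using mfps_ideal_diff_commute by (auto simp: tuple_ideal_def)

lemma tuple_ideal_diff_trans: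
  assumes "\<phi> - \<psi> \<in> tuple_ideal d" "\<psi> - \<rho> \<in> tuple_ideal d"
  shows "\<phi> - \<rho> \<in> tuple_ideal d"
  using tuple_ideal_add[OF assms] by simp

lemma tuple_eqI_ideal:
  assumes "\<And>d. \<phi> - \<psi> \<in> tuple_ideal d"
  shows "\<phi> = \<psi>"
  using assms by (auto simp: vec_eq_iff tuple_ideal_def intro: mfps_eqI_ideal)

lemma id_tuple_in_ideal [simp]: "id_tuple \<in> tuple_ideal 1"
proof (rule tuple_idealI, rule mfps_idealI)
  fix i :: 'b and \<alpha> :: "nat ^ 'b"
  assume "mdegree \<alpha> < 1"
  then show "mfps_nth ((id_tuple :: ('a, 'b) mfps_tuple) $ i) \<alpha> = 0"
    by (auto simp: id_tuple_def mfps_nth_X)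
qed

section \<open>Linear parts as matrices\<close>

lemma nth_compose_axis:
  assumes "\<psi> \<in> tuple_ideal 1"
  shows "mfps_nth (mfps_subst f \<psi>) (axis j 1)
    = (\<Sum>l\<in>UNIV. mfps_nth f (axis l 1) * mfps_nth (\<psi> $ l) (axis j 1))"
proof -
  let ?t = "\<lambda>\<alpha>. mfps_nth f \<alpha> * mfps_nth (mpow \<psi> \<alpha>) (axis j 1)"
  have "mfps_nth (mfps_subst f \<psi>) (axis j 1) = (\<Sum>\<alpha>\<in>range (\<lambda>l. axis l 1). ?t \<alpha>)"
    unfolding mfps_nth_subst
  proof (rule sum.mono_neutral_right)
    show "\<forall>\<alpha>\<in>{\<alpha>. mdegree \<alpha> \<le> mdegree (axis j 1 :: nat ^ 'b)} - range (\<lambda>l. axis l 1). ?t \<alpha> = 0"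
    proof
      fix \<alpha> :: "nat ^ 'b"
      assume "\<alpha> \<in> {\<alpha>. mdegree \<alpha> \<le> mdegree (axis j 1 :: nat ^ 'b)} - range (\<lambda>l. axis l 1)"
      then have "mdegree \<alpha> \<le> 1" "mdegree \<alpha> \<noteq> 1"
        using mdegree_eq_1_iff[of \<alpha>] by auto
      then have "\<alpha> = 0"
        using mdegree_eq_0_iff[of \<alpha>] by linarith
      \<comment> \<open>The monomial \<psi>^0 = 1 has no linear coefficient, so the index 0 drops
        out.\<close>
      moreover have "axis j 1 \<noteq> (0 :: nat ^ 'b)"
        by (metis mdegree_axis mdegree_0 one_neq_zero)
      ultimately show "?t \<alpha> = 0" by simp
    qed
  qed (auto simp: finite_mdegree_le)
  also have "\<dots> = (\<Sum>l\<in>UNIV. ?t (axis l 1))"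
    by (subst sum.reindex) (auto simp: inj_on_def axis_eq_axis)
  finally show ?thesis by simp
qed

lemma linear_matrix_nth [simp]: "linear_matrix \<phi> $ i $ j = mfps_nth (\<phi> $ i) (axis j 1)"
  by (simp add: linear_matrix_def)

lemma linear_matrix_eq_iff:
  "linear_matrix \<phi> = A \<longleftrightarrow> (\<forall>i j. mfps_nth (\<phi> $ i) (axis j 1) = A $ i $ j)"
  by (simp add: vec_eq_iff)

lemma linear_matrix_compose:
  "\<psi> \<in> tuple_ideal 1 \<Longrightarrow>
    linear_matrix (compose_tuple \<phi> \<psi>) = linear_matrix \<phi> ** linear_matrix \<psi>"
  by (simp add: linear_matrix_eq_iff matrix_matrix_mult_def nth_compose_axis
      del: One_nat_def)

lemma linear_matrix_id: "linear_matrix id_tuple = mat 1"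
  by (auto simp: linear_matrix_eq_iff id_tuple_def mat_def mfps_nth_X axis_eq_axis)

lemma tuple_ideal_2_iff:
  assumes "\<phi> \<in> tuple_ideal 1" "\<psi> \<in> tuple_ideal 1"
  shows "\<phi> - \<psi> \<in> tuple_ideal 2 \<longleftrightarrow> linear_matrix \<phi> = linear_matrix \<psi>"
proof
  assume *: "\<phi> - \<psi> \<in> tuple_ideal 2"
  have "mfps_nth (\<phi> $ i) (axis j 1) = mfps_nth (\<psi> $ i) (axis j 1)" for i j
    using mfps_idealD[OF tuple_idealD[OF *, of i], of "axis j 1"] by simp
  then show "linear_matrix \<phi> = linear_matrix \<psi>"
    by (simp add: linear_matrix_eq_iff)
next
  assume *: "linear_matrix \<phi> = linear_matrix \<psi>"
  show "\<phi> - \<psi> \<in> tuple_ideal 2"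
  proof (rule tuple_idealI, rule mfps_idealI)
    fix i and \<alpha> :: "nat ^ 'b"
    assume "mdegree \<alpha> < 2"
    then consider "mdegree \<alpha> < 1" | j where "\<alpha> = axis j 1"
      using mdegree_eq_1_iff[of \<alpha>] by fastforce
    then show "mfps_nth ((\<phi> - \<psi>) $ i) \<alpha> = 0"
    proof cases
      case 1
      then show ?thesis
        using assms[THEN tuple_idealD, THEN mfps_idealD] by simp
    next
      case 2
      then show ?thesis
        using * by (simp add: linear_matrix_eq_iff)
    qed
  qed
qed

text \<open>
  A solution is the limit of the iteration \<open>\<psi> \<mapsto> id - \<rho>(\<psi>)\<close>, which gains one correct degree per step
  because \<open>\<rho>\<close> has no linear part.
\<close>

lemma right_inverse_unipotent:
  fixes \<rho> :: "('a::comm_ring_1, 'n::finite) mfps_tuple"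
  assumes \<rho>: "\<rho> \<in> tuple_ideal 2"
  obtains \<psi> where "\<psi> \<in> tuple_ideal 1" "compose_tuple (id_tuple + \<rho>) \<psi> = id_tuple"
proof -
  define T where "T \<psi> = id_tuple - compose_tuple \<rho> \<psi>" for \<psi>
  define s where "s n = (T ^^ n) id_tuple" for n
  \<comment> \<open>Coefficientwise limit: \<open>s n\<close> and all later iterates agree in
    degrees up to n, so the coefficient at \<alpha> is final from the iterate number |\<alpha>|
    on.\<close>
  define l :: "('a, 'n) mfps_tuple"
    where "l = vec_lambda (\<lambda>i. Abs_mfps (\<lambda>\<alpha>. mfps_nth (s (mdegree \<alpha>) $ i) \<alpha>))"
  have s_0: "s 0 = id_tuple" and s_Suc: "s (Suc n) = T (s n)" for n
    by (simp_all add: s_def)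
  have T_1: "T \<psi> \<in> tuple_ideal 1" for \<psi>
    unfolding T_def
    by (intro tuple_ideal_diff id_tuple_in_ideal compose_tuple_in_ideal tuple_ideal_mono[OF \<rho>]) auto
  have T_contract: "T \<psi> - T \<psi>' \<in> tuple_ideal (2 + e)"
    if "\<psi> \<in> tuple_ideal 1" "\<psi>' \<in> tuple_ideal 1" "\<psi> - \<psi>' \<in> tuple_ideal (1 + e)" for \<psi> \<psi>' e
    using compose_tuple_diff_in_ideal[OF \<rho> that] tuple_ideal_diff_commute
    by (auto simp: T_def)
  have s_1: "s n \<in> tuple_ideal 1" for n
    by (cases n) (auto simp: s_0 s_Suc T_1 simp del: One_nat_def)
  have s_step: "s (Suc n) - s n \<in> tuple_ideal (n + 1)" for n
  proof (induction n)
    case 0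
    show ?case using tuple_ideal_diff[OF s_1 s_1] by simp
  next
    case (Suc n)
    then show ?case
      using T_contract[OF s_1 s_1, of "Suc n" n n] by (simp add: s_Suc)
  qed
  have s_le: "s (n + k) - s n \<in> tuple_ideal (n + 1)" for n k
  proof (induction k)
    case 0
    show ?case by (simp add: tuple_ideal_def)
  next
    case (Suc k)
    have "s (Suc (n + k)) - s (n + k) \<in> tuple_ideal (n + 1)"
      by (rule tuple_ideal_mono[OF s_step]) simp
    then show ?case
      using Suc tuple_ideal_diff_trans by auto
  qed
  have l_s: "l - s n \<in> tuple_ideal (1 + n)" for n
  proof (rule tuple_idealI, rule mfps_idealI)
    fix i and \<alpha> :: "nat ^ 'n"
    assume "mdegree \<alpha> < 1 + n"
    then have "s n - s (mdegree \<alpha>) \<in> tuple_ideal (mdegree \<alpha> + 1)"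
      using s_le[of "mdegree \<alpha>" "n - mdegree \<alpha>"] by simp
    from mfps_idealD[OF tuple_idealD[OF this], of \<alpha> i]
    show "mfps_nth ((l - s n) $ i) \<alpha> = 0"
      by (simp add: l_def)
  qed
  have l_1: "l \<in> tuple_ideal 1"
    using tuple_ideal_add[OF tuple_ideal_mono[OF l_s[of 0]] s_1[of 0]] by simp
  \<comment> \<open>The iterate \<open>s (Suc d) = T (s d)\<close> is close to l as an iterate and
    close to \<open>T l\<close> by contraction. The fixed point equation l = id - \<rho>(l) is the
    desired identity rearranged.\<close>
  have "l = T l"
  proof (rule tuple_eqI_ideal)
    fix d
    have "l - s (Suc d) \<in> tuple_ideal d" "s (Suc d) - T l \<in> tuple_ideal d"
      using tuple_ideal_mono[OF l_s[of "Suc d"], of d]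
        tuple_ideal_mono[OF T_contract[OF s_1 l_1], of d d d]
        l_s[of d] tuple_ideal_diff_commute by (auto simp: s_Suc)
    then show "l - T l \<in> tuple_ideal d"
      by (rule tuple_ideal_diff_trans)
  qed
  moreover have "compose_tuple (id_tuple + \<rho>) l = l + compose_tuple \<rho> l"
    by (simp add: compose_tuple_add compose_tuple_id_left[OF l_1])
  ultimately have "compose_tuple (id_tuple + \<rho>) l = id_tuple"
    by (simp add: T_def algebra_simps)
  with l_1 show thesis by (rule that)
qed

section \<open>Inverses and the group axioms\<close>

definition matrix_tuple :: "'a::comm_ring_1 ^ 'n ^ 'n \<Rightarrow> ('a, 'n::finite) mfps_tuple"
  where "matrix_tuple A = (\<chi> i. \<Sum>j\<in>UNIV. mfps_const (A $ i $ j) * mfps_X j)"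

lemma matrix_tuple_in_ideal: "matrix_tuple A \<in> tuple_ideal 1"
proof (rule tuple_idealI)
  fix i
  have "mfps_X j \<in> mfps_ideal 1" for j :: 'b
    using tuple_idealD[OF id_tuple_in_ideal, of j] by (simp add: id_tuple_def)
  then show "matrix_tuple A $ i \<in> mfps_ideal 1"
    by (auto simp: matrix_tuple_def intro!: mfps_ideal_sum mfps_ideal_mult_left)
qed

lemma linear_matrix_matrix_tuple: "linear_matrix (matrix_tuple A) = A"
  by (simp add: linear_matrix_eq_iff matrix_tuple_def mfps_nth_X axis_eq_axis
      if_distrib[of "(*) _"] cong: if_cong)

lemma homog_part_nth:
  "mfps_nth (homog_part k \<phi> $ i) \<alpha> = (if mdegree \<alpha> = k then mfps_nth (\<phi> $ i) \<alpha> else 0)"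
  by (simp add: homog_part_def mfps_nth_homog)

lemma tuple_eq_iff_nth:
  fixes \<phi> \<psi> :: "('a::comm_ring_1, 'n::finite) mfps_tuple"
  shows "\<phi> = \<psi> \<longleftrightarrow> (\<forall>i \<alpha>. mfps_nth (\<phi> $ i) \<alpha> = mfps_nth (\<psi> $ i) \<alpha>)"
  by (auto simp: vec_eq_iff intro: mfps_eqI)

lemma carrier_G_infty:
  "\<phi> \<in> carrier G_infty \<longleftrightarrow> \<phi> \<in> tuple_ideal 1 \<and> invertible (linear_matrix \<phi>)"
proof -
  have "homog_part 0 \<phi> = 0 \<longleftrightarrow> \<phi> \<in> tuple_ideal 1"
    by (auto simp: tuple_eq_iff_nth homog_part_nth tuple_ideal_def mfps_ideal_def)
  then show ?thesis by (simp add: G_infty_def)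
qed

lemma mult_G_infty [simp]: "\<phi> \<otimes>\<^bsub>G_infty\<^esub> \<psi> = compose_tuple \<phi> \<psi>"
  by (simp add: G_infty_def)

lemma one_G_infty [simp]: "\<one>\<^bsub>G_infty\<^esub> = id_tuple"
  by (simp add: G_infty_def)

text \<open>Composing on the right with the linear tuple of the inverse matrix normalises the linear
  part to the identity. The unipotent case supplies another right factor, and associativity merges
  the two.\<close>

lemma right_inverse_G_infty:
  fixes \<phi> :: "('a::field, 'n::finite) mfps_tuple"
  assumes \<phi>: "\<phi> \<in> carrier G_infty"
  obtains \<psi> where "\<psi> \<in> carrier G_infty" "compose_tuple \<phi> \<psi> = id_tuple"
proof -
  from \<phi> have \<phi>1: "\<phi> \<in> tuple_ideal 1" and inv: "invertible (linear_matrix \<phi>)"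
    by (auto simp: carrier_G_infty)
  then obtain B where B: "linear_matrix \<phi> ** B = mat 1"
    by (auto simp: invertible_def)
  define L where "L = matrix_tuple B"
  have L1: "L \<in> tuple_ideal 1"
    by (simp only: L_def matrix_tuple_in_ideal)
  have "linear_matrix (compose_tuple \<phi> L) = linear_matrix id_tuple"
    by (simp only: linear_matrix_compose[OF L1])
      (simp add: L_def linear_matrix_matrix_tuple B linear_matrix_id)
  then have "compose_tuple \<phi> L - id_tuple \<in> tuple_ideal 2"
    using tuple_ideal_2_iff compose_tuple_in_ideal[OF \<phi>1] id_tuple_in_ideal by blast
  then obtain \<psi> where \<psi>: "\<psi> \<in> tuple_ideal 1"
      "compose_tuple (id_tuple + (compose_tuple \<phi> L - id_tuple)) \<psi> = id_tuple"
    by (rule right_inverse_unipotent)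
  have L\<psi>: "compose_tuple L \<psi> \<in> tuple_ideal 1"
    by (rule compose_tuple_in_ideal[OF L1])
  have id: "compose_tuple \<phi> (compose_tuple L \<psi>) = id_tuple"
    using \<psi> by (simp add: compose_tuple_assoc[OF L1])
  then have "linear_matrix \<phi> ** linear_matrix (compose_tuple L \<psi>) = mat 1"
    by (metis linear_matrix_compose[OF L\<psi>] linear_matrix_id)
  \<comment> \<open>Over a field, a one-sided inverse of a square matrix is two-sided.\<close>
  then have "invertible (linear_matrix (compose_tuple L \<psi>))"
    using matrix_left_right_inverse invertible_def by blast
  with L\<psi> have "compose_tuple L \<psi> \<in> carrier G_infty"
    by (simp add: carrier_G_infty)
  then show thesis using id by (rule that)
qed

lemma monoid_G_infty: "monoid (G_infty :: ('a::field, 'n::finite) mfps_tuple monoid)"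
proof (rule monoidI; unfold mult_G_infty one_G_infty)
  fix \<phi> \<psi> :: "('a, 'n) mfps_tuple"
  assume "\<phi> \<in> carrier G_infty" "\<psi> \<in> carrier G_infty"
  then show "compose_tuple \<phi> \<psi> \<in> carrier G_infty"
    unfolding carrier_G_infty
    by (metis compose_tuple_in_ideal invertible_mult linear_matrix_compose)
next
  show "id_tuple \<in> carrier (G_infty :: ('a, 'n) mfps_tuple monoid)"
    unfolding carrier_G_infty linear_matrix_id
    by (auto simp: invertible_def intro!: exI[of _ "mat 1"] simp del: One_nat_def)
qed (auto simp: carrier_G_infty compose_tuple_assoc compose_tuple_id_left simp del: One_nat_def)

lemma group_G_infty: "group (G_infty :: ('a::field, 'n::finite) mfps_tuple monoid)"
proof -
  interpret monoid "G_infty :: ('a, 'n) mfps_tuple monoid"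
    by (rule monoid_G_infty)
  show ?thesis
  proof (rule group_l_invI)
    fix \<phi> :: "('a, 'n) mfps_tuple"
    assume \<phi>: "\<phi> \<in> carrier G_infty"
    obtain \<psi> where \<psi>: "\<psi> \<in> carrier G_infty" "\<phi> \<otimes>\<^bsub>G_infty\<^esub> \<psi> = \<one>\<^bsub>G_infty\<^esub>"
      using right_inverse_G_infty[OF \<phi>] by (metis mult_G_infty one_G_infty)
    obtain \<rho> where \<rho>: "\<rho> \<in> carrier G_infty" "\<psi> \<otimes>\<^bsub>G_infty\<^esub> \<rho> = \<one>\<^bsub>G_infty\<^esub>"
      using right_inverse_G_infty[OF \<psi>(1)] by (metis mult_G_infty one_G_infty)
    \<comment> \<open>A right inverse that has a right inverse itself is two-sided: \<rho> = (\<phi>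
      \<psi>) \<rho> = \<phi> (\<psi> \<rho>) = \<phi>.\<close>
    have "\<rho> = \<phi>"
      using \<phi> \<psi> \<rho> by (metis m_assoc l_one r_one)
    with \<psi> \<rho> show "\<exists>\<psi>\<in>carrier G_infty. \<psi> \<otimes>\<^bsub>G_infty\<^esub> \<phi> = \<one>\<^bsub>G_infty\<^esub>"
      by blast
  qed
qed


section \<open>Tuples with scalar linear part\<close>

lemma scale_tuple_nth [simp]: "scale_tuple c \<phi> $ i = mfps_const c * \<phi> $ i"
  by (simp add: scale_tuple_def)

lemma scale_tuple_in_ideal: "\<phi> \<in> tuple_ideal d \<Longrightarrow> scale_tuple c \<phi> \<in> tuple_ideal d"
  by (simp add: tuple_ideal_def mfps_ideal_mult_left)

lemma scale_tuple_diff: "scale_tuple c (\<phi> - \<psi>) = scale_tuple c \<phi> - scale_tuple c \<psi>"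
  by (simp add: vec_eq_iff algebra_simps)

lemma scale_tuple_scale: "scale_tuple a (scale_tuple b \<phi>) = scale_tuple (a * b) \<phi>"
  by (simp add: vec_eq_iff mfps_const_mult mult.assoc)

lemma scale_tuple_add_left: "scale_tuple (a + b) \<phi> = scale_tuple a \<phi> + scale_tuple b \<phi>"
  by (simp add: vec_eq_iff mfps_const_add algebra_simps)

lemma scale_tuple_1 [simp]: "scale_tuple 1 \<phi> = \<phi>"
  by (simp add: vec_eq_iff)

text \<open>Order 2 of the difference fixes both low degrees at once: linear part c id and constant
  term 0.\<close>

definition linear_scalar :: "'a::comm_ring_1 \<Rightarrow> ('a, 'n::finite) mfps_tuple \<Rightarrow> bool"
  where "linear_scalar c \<phi> \<longleftrightarrow> \<phi> - scale_tuple c id_tuple \<in> tuple_ideal 2"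

lemma linear_scalarI:
  assumes "\<phi> \<in> tuple_ideal 1" "homog_part 1 \<phi> = scale_tuple c id_tuple"
  shows "linear_scalar c \<phi>"
  unfolding linear_scalar_def
proof (rule tuple_idealI, rule mfps_idealI)
  fix i and \<alpha> :: "nat ^ 'b"
  assume \<alpha>: "mdegree \<alpha> < 2"
  have eq: "mfps_nth (scale_tuple c id_tuple $ i) \<alpha>
      = (if mdegree \<alpha> = 1 then mfps_nth (\<phi> $ i) \<alpha> else 0)"
    by (simp only: homog_part_nth assms(2)[symmetric])
  show "mfps_nth ((\<phi> - scale_tuple c id_tuple) $ i) \<alpha> = 0"
  proof (cases "mdegree \<alpha> = 1")
    case True
    then show ?thesis using eq by simp
  next
    case False
    then have "mdegree \<alpha> < 1"
      using \<alpha> by linarith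
    then have "mfps_nth (\<phi> $ i) \<alpha> = 0"
      by (rule mfps_idealD[OF tuple_idealD[OF assms(1)]])
    then show ?thesis using False eq by simp
  qed
qed

lemma linear_scalar_in_ideal:
  assumes "linear_scalar c \<phi>"
  shows "\<phi> \<in> tuple_ideal 1"
proof -
  have "\<phi> - scale_tuple c id_tuple \<in> tuple_ideal 1"
    by (rule tuple_ideal_mono[OF assms[unfolded linear_scalar_def]]) simp
  from tuple_ideal_add[OF this scale_tuple_in_ideal[OF id_tuple_in_ideal, of c]]
  show ?thesis by simp
qed

lemma linear_scalar_cong:
  assumes "\<phi> - \<psi> \<in> tuple_ideal 2" "linear_scalar c \<phi>"
  shows "linear_scalar c \<psi>"
  using tuple_ideal_diff[OF assms(2)[unfolded linear_scalar_def] assms(1)]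
  by (simp add: linear_scalar_def)

lemma linear_scalar_matrix:
  assumes "linear_scalar c \<phi>"
  shows "linear_matrix \<phi> = mat c"
proof -
  have "linear_matrix \<phi> = linear_matrix (scale_tuple c id_tuple)"
    using assms tuple_ideal_2_iff[OF linear_scalar_in_ideal[OF assms]
      scale_tuple_in_ideal[OF id_tuple_in_ideal, of c]]
    by (simp add: linear_scalar_def)
  also have "\<dots> = mat c"
    by (auto simp: linear_matrix_eq_iff id_tuple_def mat_def mfps_nth_X axis_eq_axis)
  finally show ?thesis .
qed

text \<open>A diagonal entry of the linear matrix recovers the scalar, as there is at least one
  variable. This turns \<phi>^n = id into \<omega>^n = 1.\<close>

lemma linear_scalar_unique:
  fixes \<phi> :: "('a::comm_ring_1, 'n::finite) mfps_tuple"
  assumes "linear_scalar a \<phi>" "linear_scalar b \<phi>"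
  shows "a = b"
proof -
  have "(mat a :: 'a ^ 'n ^ 'n) = mat b"
    using linear_scalar_matrix[OF assms(1)] linear_scalar_matrix[OF assms(2)] by simp
  then have "(mat a :: 'a ^ 'n ^ 'n) $ i $ i = mat b $ i $ i" for i
    by simp
  then show ?thesis by (simp add: mat_def)
qed

lemma linear_scalar_id: "linear_scalar 1 id_tuple"
  by (simp add: linear_scalar_def tuple_ideal_def)

text \<open>Separates c id, which acts by exact scaling, from a remainder that has order 2 whenever
  \<phi> has linear part c id.\<close>

lemma compose_linear_scalar:
  assumes "\<psi> \<in> tuple_ideal 1"
  shows "compose_tuple \<phi> \<psi>
    = scale_tuple c \<psi> + compose_tuple (\<phi> - scale_tuple c id_tuple) \<psi>"
  using assms
  by (simp add: vec_eq_iff mfps_subst_diff mfps_subst_const_mult id_tuple_def mfps_subst_X)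

lemma linear_scalar_compose:
  assumes \<phi>: "linear_scalar a \<phi>" and \<psi>: "linear_scalar b \<psi>"
  shows "linear_scalar (a * b) (compose_tuple \<phi> \<psi>)"
proof -
  have "compose_tuple (\<phi> - scale_tuple a id_tuple) \<psi> \<in> tuple_ideal 2"
    using \<phi> by (simp add: linear_scalar_def compose_tuple_in_ideal)
  moreover have "scale_tuple a (\<psi> - scale_tuple b id_tuple) \<in> tuple_ideal 2"
    using \<psi> by (simp add: linear_scalar_def scale_tuple_in_ideal)
  ultimately have "compose_tuple (\<phi> - scale_tuple a id_tuple) \<psi>
      + scale_tuple a (\<psi> - scale_tuple b id_tuple) \<in> tuple_ideal 2"
    by (rule tuple_ideal_add)
  also have "compose_tuple (\<phi> - scale_tuple a id_tuple) \<psi> + scale_tuple a (\<psi> - scale_tuple b id_tuple)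
      = compose_tuple \<phi> \<psi> - scale_tuple (a * b) id_tuple"
    using compose_linear_scalar[OF linear_scalar_in_ideal[OF \<psi>], of \<phi> a]
    by (simp add: scale_tuple_diff scale_tuple_scale)
  finally show ?thesis by (simp add: linear_scalar_def)
qed

lemma linear_scalar_pow:
  "linear_scalar c \<phi> \<Longrightarrow> linear_scalar (c ^ j) (\<phi> [^]\<^bsub>G_infty\<^esub> j)"
proof (induction j)
  case 0
  then show ?case by (simp add: monoid.nat_pow_0[OF monoid_G_infty] linear_scalar_id)
next
  case (Suc j)
  then show ?case
    using linear_scalar_compose[of "c ^ j" "\<phi> [^]\<^bsub>G_infty\<^esub> j" c \<phi>]
    by (simp add: monoid.nat_pow_Suc[OF monoid_G_infty] mult.commute)
qed

lemma compose_tuple_diff_right_approx: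
  assumes \<phi>: "linear_scalar c \<phi>" and \<psi>: "\<psi> \<in> tuple_ideal 1" "\<psi>' \<in> tuple_ideal 1"
    and N: "N \<ge> 1" "\<psi> - \<psi>' \<in> tuple_ideal N"
  shows "compose_tuple \<phi> \<psi> - compose_tuple \<phi> \<psi>' - scale_tuple c (\<psi> - \<psi>') \<in> tuple_ideal (N + 1)"
proof -
  let ?r = "\<phi> - scale_tuple c id_tuple"
  \<comment> \<open>The difference has order N = 1 + e with e = N - 1, and the remainder has order
    2, so the error starts in degree 2 + (N - 1) = N + 1.\<close>
  have "compose_tuple ?r \<psi> - compose_tuple ?r \<psi>' \<in> tuple_ideal (2 + (N - 1))"
    using \<phi> N by (intro compose_tuple_diff_in_ideal \<psi>) (auto simp: linear_scalar_def)
  also have "compose_tuple ?r \<psi> - compose_tuple ?r \<psi>'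
      = compose_tuple \<phi> \<psi> - compose_tuple \<phi> \<psi>' - scale_tuple c (\<psi> - \<psi>')"
    using compose_linear_scalar[OF \<psi>(1), of \<phi> c] compose_linear_scalar[OF \<psi>(2), of \<phi> c]
    by (simp add: scale_tuple_diff)
  finally show ?thesis using N by simp
qed

lemma mpow_scale: "mpow (scale_tuple c \<psi>) \<alpha> = mfps_const (c ^ mdegree \<alpha>) * mpow \<psi> \<alpha>"
  by (simp add: mpow_def mdegree_def power_mult_distrib prod.distrib power_sum mfps_const_prod
      mfps_const_power)

lemma mfps_nth_subst_scale:
  "mfps_nth (mfps_subst f (scale_tuple c id_tuple)) \<beta> = c ^ mdegree \<beta> * mfps_nth f \<beta>"
  by (simp add: mfps_nth_subst mpow_scale mfps_nth_mpow_id finite_mdegree_le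
      if_distrib[of "(*) _"] cong: if_cong)

text \<open>Replacing \<psi> by c id changes the inner tuple only from degree 2 on, which costs
  terms of degree at least N + 1. Under c id the coefficients of degree N are multiplied by c^N, and
  h has none below.\<close>

lemma compose_tuple_left_approx:
  assumes h: "h \<in> tuple_ideal N" and \<psi>: "linear_scalar c \<psi>"
  shows "compose_tuple h \<psi> - scale_tuple (c ^ N) h \<in> tuple_ideal (N + 1)"
proof (rule tuple_ideal_diff_trans)
  show "compose_tuple h \<psi> - compose_tuple h (scale_tuple c id_tuple) \<in> tuple_ideal (N + 1)"
    using \<psi> linear_scalar_in_ideal[OF \<psi>]
    by (intro compose_tuple_diff_in_ideal h scale_tuple_in_ideal id_tuple_in_ideal)
      (auto simp: linear_scalar_def numeral_2_eq_2)
  show "compose_tuple h (scale_tuple c id_tuple) - scale_tuple (c ^ N) h \<in> tuple_ideal (N + 1)"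
  proof (rule tuple_idealI, rule mfps_idealI)
    fix i and \<alpha> :: "nat ^ 'b"
    assume "mdegree \<alpha> < N + 1"
    then consider "mdegree \<alpha> < N" | "mdegree \<alpha> = N" by linarith
    then show "mfps_nth ((compose_tuple h (scale_tuple c id_tuple) - scale_tuple (c ^ N) h) $ i) \<alpha> = 0"
      using mfps_idealD[OF tuple_idealD[OF h], of \<alpha> i]
      by cases (auto simp: mfps_nth_subst_scale)
  qed
qed


section \<open>Homogeneous parts of powers\<close>

lemma homog_part_diff: "homog_part k (\<phi> - \<psi>) = homog_part k \<phi> - homog_part k \<psi>"
  by (simp add: tuple_eq_iff_nth homog_part_nth)

lemma homog_part_scale: "homog_part k (scale_tuple c \<phi>) = scale_tuple c (homog_part k \<phi>)"
  by (simp add: tuple_eq_iff_nth homog_part_nth)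

lemma homog_part_eq_0: "\<phi> \<in> tuple_ideal (k + 1) \<Longrightarrow> homog_part k \<phi> = 0"
  by (auto simp: tuple_eq_iff_nth homog_part_nth tuple_ideal_def mfps_ideal_def)

lemma tuple_ideal_Suc:
  assumes "\<phi> \<in> tuple_ideal d" "homog_part d \<phi> = 0"
  shows "\<phi> \<in> tuple_ideal (d + 1)"
proof (rule tuple_idealI, rule mfps_idealI)
  fix i and \<alpha> :: "nat ^ 'b"
  assume "mdegree \<alpha> < d + 1"
  then consider "mdegree \<alpha> < d" | "mdegree \<alpha> = d" by linarith
  then show "mfps_nth (\<phi> $ i) \<alpha> = 0"
  proof cases
    case 1
    then show ?thesis by (rule mfps_idealD[OF tuple_idealD[OF assms(1)]])
  next
    case 2
    then have "mfps_nth (\<phi> $ i) \<alpha> = mfps_nth (homog_part d \<phi> $ i) \<alpha>"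
      by (simp add: homog_part_nth)
    then show ?thesis by (simp add: assms(2))
  qed
qed

lemma homog_part_id:
  assumes "k \<noteq> 1"
  shows "homog_part k (id_tuple :: ('a::comm_ring_1, 'n::finite) mfps_tuple) = 0"
  unfolding tuple_eq_iff_nth
proof (intro allI)
  fix i and \<alpha> :: "nat ^ 'n"
  have "mdegree \<alpha> = k \<Longrightarrow> \<alpha> \<noteq> axis i 1"
    using assms by auto
  then show "mfps_nth (homog_part k (id_tuple :: ('a, 'n) mfps_tuple) $ i) \<alpha> = mfps_nth (0 $ i) \<alpha>"
    by (auto simp: homog_part_nth id_tuple_def mfps_nth_X)
qed

lemma nth_sum_homog_part:
  "mfps_nth ((\<Sum>i=a..b. homog_part i \<phi>) $ l) \<alpha>
    = (if mdegree \<alpha> \<in> {a..b} then mfps_nth (\<phi> $ l) \<alpha> else 0)"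
proof -
  have "mfps_nth ((\<Sum>i=a..b. homog_part i \<phi>) $ l) \<alpha>
      = (\<Sum>i=a..b. if mdegree \<alpha> = i then mfps_nth (\<phi> $ l) \<alpha> else 0)"
    by (simp add: homog_part_nth)
  then show ?thesis by simp
qed

text \<open>With a and b the previous powers of \<phi> and \<psi>, split a(\<phi>) - b(\<psi>) = (a
  - b)(\<phi>) + (b(\<phi>) - b(\<psi>)). A factor inside the perturbed one multiplies the leading
  term by \<omega>^N, a factor outside by \<omega>. As \<omega>^N = \<omega>, all Suc j positions
  contribute \<omega>^j alike.\<close>

lemma pow_diff_approx:
  fixes \<phi> \<psi> :: "('a::field, 'n::finite) mfps_tuple"
  assumes \<phi>: "linear_scalar \<omega> \<phi>" and \<psi>: "linear_scalar \<omega> \<psi>"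
    and N: "N \<ge> 1" "\<phi> - \<psi> \<in> tuple_ideal N" and \<omega>: "\<omega> ^ N = \<omega>"
  shows "\<phi> [^]\<^bsub>G_infty\<^esub> Suc j - \<psi> [^]\<^bsub>G_infty\<^esub> Suc j
    - scale_tuple (of_nat (Suc j) * \<omega> ^ j) (\<phi> - \<psi>) \<in> tuple_ideal (N + 1)"
proof -
  interpret monoid "G_infty :: ('a, 'n) mfps_tuple monoid"
    by (rule monoid_G_infty)
  show ?thesis
  proof (induction j)
    case 0
    show ?case
      using linear_scalar_in_ideal[OF \<phi>] linear_scalar_in_ideal[OF \<psi>]
      by (simp add: nat_pow_Suc compose_tuple_id_left) (simp add: tuple_ideal_def)
  next
    case (Suc j)
    let ?a = "\<phi> [^]\<^bsub>G_infty\<^esub> Suc j" and ?b = "\<psi> [^]\<^bsub>G_infty\<^esub> Suc j"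
    let ?c = "of_nat (Suc j) * \<omega> ^ j"
    have "?a - ?b - scale_tuple ?c (\<phi> - \<psi>) \<in> tuple_ideal N"
      by (rule tuple_ideal_mono[OF Suc.IH]) simp
    from tuple_ideal_add[OF this scale_tuple_in_ideal[OF N(2), of ?c]]
    have ab: "?a - ?b \<in> tuple_ideal N" by simp
    have 1: "compose_tuple (?a - ?b) \<phi> - scale_tuple \<omega> (?a - ?b) \<in> tuple_ideal (N + 1)"
      using compose_tuple_left_approx[OF ab \<phi>] by (simp only: \<omega>)
    have 2: "scale_tuple \<omega> (?a - ?b) - scale_tuple \<omega> (scale_tuple ?c (\<phi> - \<psi>)) \<in> tuple_ideal (N + 1)"
      using scale_tuple_in_ideal[OF Suc.IH, of \<omega>] by (simp only: scale_tuple_diff)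
    have 3: "compose_tuple ?b \<phi> - compose_tuple ?b \<psi> - scale_tuple (\<omega> ^ Suc j) (\<phi> - \<psi>)
        \<in> tuple_ideal (N + 1)"
      by (intro compose_tuple_diff_right_approx linear_scalar_pow \<psi> N
          linear_scalar_in_ideal[OF \<phi>] linear_scalar_in_ideal[OF \<psi>])
    have c: "of_nat (Suc (Suc j)) * \<omega> ^ Suc j = \<omega> * ?c + \<omega> ^ Suc j"
      by (simp add: algebra_simps)
    have "\<phi> [^]\<^bsub>G_infty\<^esub> Suc (Suc j) - \<psi> [^]\<^bsub>G_infty\<^esub> Suc (Suc j)
          - scale_tuple (of_nat (Suc (Suc j)) * \<omega> ^ Suc j) (\<phi> - \<psi>)
        = (compose_tuple (?a - ?b) \<phi> - scale_tuple \<omega> (scale_tuple ?c (\<phi> - \<psi>)))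
          + (compose_tuple ?b \<phi> - compose_tuple ?b \<psi> - scale_tuple (\<omega> ^ Suc j) (\<phi> - \<psi>))"
      unfolding c nat_pow_Suc[of _ "Suc j"]
      by (simp add: compose_tuple_diff scale_tuple_add_left scale_tuple_scale
          del: nat_pow_Suc of_nat_Suc power_Suc)
    also have "\<dots> \<in> tuple_ideal (N + 1)"
      by (intro tuple_ideal_add 3 tuple_ideal_diff_trans[OF 1 2])
    finally show ?case .
  qed
qed

lemma commuting_in_ideal_Suc:
  fixes \<phi> h :: "('a::field, 'n::finite) mfps_tuple"
  assumes \<phi>: "linear_scalar \<omega> \<phi>" and d: "d \<ge> 1" and h: "h \<in> tuple_ideal d"
    and comm: "compose_tuple \<phi> (id_tuple + h) = compose_tuple (id_tuple + h) \<phi>"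
    and ne: "\<omega> ^ d \<noteq> \<omega>"
  shows "h \<in> tuple_ideal (d + 1)"
proof -
  note \<phi>1 = linear_scalar_in_ideal[OF \<phi>]
  have "id_tuple + h \<in> tuple_ideal 1"
    by (intro tuple_ideal_add id_tuple_in_ideal tuple_ideal_mono[OF h d])
  then have "compose_tuple \<phi> (id_tuple + h) - compose_tuple \<phi> id_tuple
      - scale_tuple \<omega> (id_tuple + h - id_tuple) \<in> tuple_ideal (d + 1)"
    using h d by (intro compose_tuple_diff_right_approx[OF \<phi>]) (auto simp del: One_nat_def)
  \<comment> \<open>After rewriting with \<open>comm\<close>, the summand id contributes \<phi>,
    which cancels against \<phi> composed with id.\<close>
  then have "compose_tuple h \<phi> - scale_tuple \<omega> h \<in> tuple_ideal (d + 1)"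
    by (simp add: comm compose_tuple_add compose_tuple_id_left[OF \<phi>1])
  moreover have "compose_tuple h \<phi> - scale_tuple (\<omega> ^ d) h \<in> tuple_ideal (d + 1)"
    by (rule compose_tuple_left_approx[OF h \<phi>])
  ultimately have *: "scale_tuple (\<omega> ^ d) h - scale_tuple \<omega> h \<in> tuple_ideal (d + 1)"
    using tuple_ideal_diff_commute tuple_ideal_diff_trans by blast
  have eq: "scale_tuple (\<omega> ^ d) h - scale_tuple \<omega> h = scale_tuple (\<omega> ^ d - \<omega>) h"
    using scale_tuple_add_left[of "\<omega> ^ d - \<omega>" \<omega> h] by simp
  have "scale_tuple (1 / (\<omega> ^ d - \<omega>)) (scale_tuple (\<omega> ^ d - \<omega>) h) \<in> tuple_ideal (d + 1)"
    using * unfolding eq by (rule scale_tuple_in_ideal)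
  then show ?thesis
    using ne by (simp add: scale_tuple_scale)
qed

section \<open>Orders and resonant degrees\<close>

lemma primitive_root_of_unity_pow_eq_1:
  fixes \<omega> :: "'a::field"
  assumes "primitive_root_of_unity m \<omega>"
  shows "\<omega> ^ n = 1 \<longleftrightarrow> m dvd n"
proof -
  define R where "R = (ring_of_type_algebra :: 'a ring)"
  interpret R: field R
    unfolding R_def by (rule field_from_type_algebra)
  interpret U: group "units_of R"
    by (rule R.units_group)
  from assms have \<omega>: "\<omega> \<in> carrier (units_of R)" "U.ord \<omega> = m"
    by (auto simp: primitive_root_of_unity_def R_def)
  \<comment> \<open>Powers in the unit group are ordinary powers, so the order in it becomes a
    divisibility statement about exponents.\<close>
  have "\<omega> [^]\<^bsub>units_of R\<^esub> n = \<omega> ^ n"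
    by (induction n) (auto simp: U.nat_pow_Suc units_of_mult units_of_one R_def
        ring_of_type_algebra_def mult.commute)
  then show ?thesis
    using U.pow_eq_id[OF \<omega>(1), of n] \<omega>(2)
    by (simp add: units_of_one R_def ring_of_type_algebra_def)
qed

lemma pow_eq_id_iff_homog_parts:
  fixes \<phi> :: "('a::field, 'n::finite) mfps_tuple"
  assumes m: "m \<ge> 1" and \<omega>: "primitive_root_of_unity m \<omega>" and \<phi>: "linear_scalar \<omega> \<phi>"
    and carrier: "\<phi> \<in> carrier G_infty"
  shows "\<phi> [^]\<^bsub>G_infty\<^esub> m = id_tuple
    \<longleftrightarrow> (\<forall>k\<ge>1. homog_part (m * k + 1) (\<phi> [^]\<^bsub>G_infty\<^esub> m) = 0)"
proof
  assume "\<phi> [^]\<^bsub>G_infty\<^esub> m = id_tuple"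
  then show "\<forall>k\<ge>1. homog_part (m * k + 1) (\<phi> [^]\<^bsub>G_infty\<^esub> m) = 0"
    using m by (auto intro!: homog_part_id)
next
  interpret group "G_infty :: ('a, 'n) mfps_tuple monoid"
    by (rule group_G_infty)
  note pow_1 = primitive_root_of_unity_pow_eq_1[OF \<omega>]
  assume zero: "\<forall>k\<ge>1. homog_part (m * k + 1) (\<phi> [^]\<^bsub>G_infty\<^esub> m) = 0"
  define h where "h = \<phi> [^]\<^bsub>G_infty\<^esub> m - id_tuple"
  have pow: "\<phi> [^]\<^bsub>G_infty\<^esub> m = id_tuple + h"
    by (simp add: h_def)
  have "linear_scalar (\<omega> ^ m) (\<phi> [^]\<^bsub>G_infty\<^esub> m)"
    using \<phi> by (rule linear_scalar_pow)
  then have h2: "h \<in> tuple_ideal 2"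
    using pow_1[of m] by (simp add: linear_scalar_def h_def)
  \<comment> \<open>A power commutes with its base: a factor of \<phi>^(m+1) can be split off at
    either end.\<close>
  have "compose_tuple \<phi> (\<phi> [^]\<^bsub>G_infty\<^esub> m) = compose_tuple (\<phi> [^]\<^bsub>G_infty\<^esub> m) \<phi>"
    using nat_pow_Suc[of \<phi> m] nat_pow_Suc2[OF carrier, of m] by simp
  then have comm: "compose_tuple \<phi> (id_tuple + h) = compose_tuple (id_tuple + h) \<phi>"
    by (simp only: pow)
  \<comment> \<open>The induction starts in degree 2 because \<omega>^m = 1 already removes the
    linear part of h.\<close>
  have "h \<in> tuple_ideal (d + 2)" for d
  proof (induction d)
    case 0
    show ?case using h2 by (simp add: numeral_2_eq_2)
  next
    case (Suc d)
    show ?case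
    proof (cases "\<omega> ^ (d + 2) = \<omega>")
      case False
      then show ?thesis
        using commuting_in_ideal_Suc[OF \<phi> _ Suc comm] by simp
    next
      case True
      \<comment> \<open>Resonant case: cancelling \<omega>, which is nonzero since \<omega>^m = 1,
        gives \<omega>^(d+1) = 1. Hence d + 2 = m k + 1 with k \<ge> 1, a degree in which the part
        vanishes by assumption.\<close>
      have "\<omega> \<noteq> 0"
        using pow_1[of m] m by (auto simp: power_0_left)
      with True have "\<omega> ^ (d + 1) = 1" by simp
      then obtain k where k: "d + 1 = m * k"
        using pow_1[of "d + 1"] by (auto elim: dvdE)
      then have "k \<ge> 1" by (cases k) auto
      then have "homog_part (d + 2) (\<phi> [^]\<^bsub>G_infty\<^esub> m) = 0"
        using zero k by (metis add_Suc_right one_add_one plus_1_eq_Suc add.assoc)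
      then have "homog_part (d + 2) h = 0"
        by (simp add: h_def homog_part_diff homog_part_id)
      with Suc show ?thesis
        using tuple_ideal_Suc by fastforce
    qed
  qed
  then have "h \<in> tuple_ideal d" for d
    using tuple_ideal_mono le_add1 by blast
  then show "\<phi> [^]\<^bsub>G_infty\<^esub> m = id_tuple"
    by (intro tuple_eqI_ideal) (simp add: h_def)
qed

text \<open>Proper divisors of m are excluded as orders by linear parts: \<phi>^n = id forces
  \<omega>^n = 1, hence m divides n.\<close>

lemma periodic_iff_pow_eq_id:
  fixes \<phi> :: "('a::field, 'n::finite) mfps_tuple"
  assumes \<omega>: "primitive_root_of_unity m \<omega>" and \<phi>: "linear_scalar \<omega> \<phi>"
    and carrier: "\<phi> \<in> carrier G_infty"
  shows "periodic m \<phi> \<longleftrightarrow> \<phi> [^]\<^bsub>G_infty\<^esub> m = id_tuple"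
proof -
  interpret group "G_infty :: ('a, 'n) mfps_tuple monoid"
    by (rule group_G_infty)
  have "m dvd n" if "\<phi> [^]\<^bsub>G_infty\<^esub> n = id_tuple" for n
  proof -
    have "linear_scalar (\<omega> ^ n) (id_tuple :: ('a, 'n) mfps_tuple)"
      using linear_scalar_pow[OF \<phi>, of n] that by simp
    then have "\<omega> ^ n = 1"
      using linear_scalar_unique linear_scalar_id by blast
    then show ?thesis
      by (simp add: primitive_root_of_unity_pow_eq_1[OF \<omega>])
  qed
  moreover have "\<phi> [^]\<^bsub>G_infty\<^esub> n = id_tuple" if "\<phi> [^]\<^bsub>G_infty\<^esub> m = id_tuple" "m dvd n" for n
    using that nat_pow_pow[OF carrier, of m] nat_pow_one by (auto simp: dvd_def)
  ultimately show ?thesis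
    unfolding periodic_def ord_unique[OF carrier] using carrier by auto
qed

theorem theorem3:
  fixes \<phi> :: "('a::field, 'n::finite) mfps_tuple" and \<omega> :: 'a and m :: nat
  assumes "m \<ge> 2"
    and "\<not> CHAR('a) dvd m"
    and "primitive_root_of_unity m \<omega>"
    and "\<phi> \<in> carrier G_infty"
    and "homog_part 1 \<phi> = scale_tuple \<omega> id_tuple"
  shows "periodic m \<phi> \<longleftrightarrow>
    (\<forall>k\<ge>1. homog_part (m * k + 1) \<phi> =
      scale_tuple (- (\<omega> / of_nat m))
        (homog_part (m * k + 1)
          ((\<Sum>i=1..m * k. homog_part i \<phi>) [^]\<^bsub>G_infty\<^esub> m)))"
proof -
  note pow_1 = primitive_root_of_unity_pow_eq_1[OF assms(3)]
  have \<phi>1: "\<phi> \<in> tuple_ideal 1"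
    using assms(4) by (simp add: carrier_G_infty)
  have \<phi>: "linear_scalar \<omega> \<phi>"
    by (rule linear_scalarI[OF \<phi>1 assms(5)])
  have m0: "of_nat m \<noteq> (0 :: 'a)"
    using assms(2) by (simp add: of_nat_eq_0_iff_char_dvd)
  \<comment> \<open>The exponent m - 1 is written as j; then \<omega>^j is the inverse of
    \<omega>.\<close>
  obtain j where j: "m = Suc j"
    using assms(1) by (cases m) auto
  have \<omega>: "\<omega> * \<omega> ^ j = 1"
    using pow_1[of m] by (simp add: j)
  have "homog_part (m * k + 1) (\<phi> [^]\<^bsub>G_infty\<^esub> m) = 0 \<longleftrightarrow>
      homog_part (m * k + 1) \<phi> = scale_tuple (- (\<omega> / of_nat m))
        (homog_part (m * k + 1) ((\<Sum>i=1..m * k. homog_part i \<phi>) [^]\<^bsub>G_infty\<^esub> m))"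
    if k: "k \<ge> 1" for k
  proof -
    let ?N = "m * k + 1"
    define \<psi> where "\<psi> = (\<Sum>i=1..m * k. homog_part i \<phi>)"
    have diff: "\<phi> - \<psi> \<in> tuple_ideal ?N"
    proof (rule tuple_idealI, rule mfps_idealI)
      fix i and \<alpha> :: "nat ^ 'n"
      assume "mdegree \<alpha> < ?N"
      \<comment> \<open>The truncation starts at degree 1; in degree 0 both tuples vanish because
        \<phi> has no constant term.\<close>
      then have "mdegree \<alpha> < 1 \<or> mdegree \<alpha> \<in> {1..m * k}"
        unfolding atLeastAtMost_iff by linarith
      then show "mfps_nth ((\<phi> - \<psi>) $ i) \<alpha> = 0"
        unfolding \<psi>_def vector_minus_component mfps_nth_diff nth_sum_homog_part
        using mfps_idealD[OF tuple_idealD[OF \<phi>1], of \<alpha> i] by auto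
    qed
    \<comment> \<open>Guarantees that the truncation keeps the linear part \<omega> id.\<close>
    have N2: "2 \<le> ?N"
      using k assms(1) by (cases k) auto
    have \<psi>: "linear_scalar \<omega> \<psi>"
      by (rule linear_scalar_cong[OF tuple_ideal_mono[OF diff N2] \<phi>])
    have "\<omega> ^ ?N = \<omega>"
      using pow_1[of "m * k"] by simp
    then have "\<phi> [^]\<^bsub>G_infty\<^esub> m - \<psi> [^]\<^bsub>G_infty\<^esub> m
        - scale_tuple (of_nat m * \<omega> ^ j) (\<phi> - \<psi>) \<in> tuple_ideal (?N + 1)"
      unfolding j using diff by (intro pow_diff_approx \<phi> \<psi>) (auto simp: j)
    from homog_part_eq_0[OF this]
    have H: "homog_part ?N (\<phi> [^]\<^bsub>G_infty\<^esub> m) - homog_part ?N (\<psi> [^]\<^bsub>G_infty\<^esub> m)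
        = scale_tuple (of_nat m * \<omega> ^ j) (homog_part ?N \<phi> - homog_part ?N \<psi>)"
      by (simp only: homog_part_diff homog_part_scale right_minus_eq)
    \<comment> \<open>The truncation stops just below degree N = m k + 1, so the leading term of the
      difference is \<phi>_N itself.\<close>
    have "homog_part ?N \<psi> = 0"
      unfolding tuple_eq_iff_nth homog_part_nth \<psi>_def nth_sum_homog_part by auto
    with H have H: "homog_part ?N (\<phi> [^]\<^bsub>G_infty\<^esub> m)
        = homog_part ?N (\<psi> [^]\<^bsub>G_infty\<^esub> m) + scale_tuple (of_nat m * \<omega> ^ j) (homog_part ?N \<phi>)"
      by (simp add: algebra_simps)
    \<comment> \<open>Coefficientwise, the vanishing of (\<phi>^m)_N is a linear equation for the
      coefficient x of \<phi>_N, with y from (\<psi>^m)_N. Its solution uses m \<noteq> 0 in K and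
      that \<omega>^j inverts \<omega>.\<close>
    have field: "y + of_nat m * \<omega> ^ j * x = 0 \<longleftrightarrow> x = - (\<omega> / of_nat m) * y" for x y :: 'a
    proof
      assume "y + of_nat m * \<omega> ^ j * x = 0"
      then have "y = - (of_nat m * \<omega> ^ j * x)"
        by (simp add: add_eq_0_iff2)
      then have "- (\<omega> / of_nat m) * y = (\<omega> * \<omega> ^ j) * x"
        using m0 by simp
      then show "x = - (\<omega> / of_nat m) * y" by (simp add: \<omega>)
    next
      assume "x = - (\<omega> / of_nat m) * y"
      then have "of_nat m * \<omega> ^ j * x = - ((\<omega> * \<omega> ^ j) * y)"
        using m0 by simp
      then show "y + of_nat m * \<omega> ^ j * x = 0" by (simp add: \<omega>)
    qed
    show ?thesis
      unfolding \<psi>_def[symmetric] H tuple_eq_iff_nth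
      by (simp add: field del: of_nat_Suc)
  qed
  then show ?thesis
    using periodic_iff_pow_eq_id[OF assms(3) \<phi> assms(4)]
      pow_eq_id_iff_homog_parts[OF _ assms(3) \<phi> assms(4)] assms(1) by auto
qed

end
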